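(* Let $\mathbf Q\in\mathbb R^{n\times n}$ be symmetric positive definite with bandwidth $k\ge 1$ (i.e. $Q_{ij}=0$ whenever $|i-j|>k$), let $\mathbf c,\mathbf d\in\mathbb R^n$, and let $h^*$ be the optimal objective value of $$\min\Big\{\mathbf d^\top \mathbf x+\mathbf c^\top \mathbf z+\tfrac12 \mathbf x^\top \mathbf Q\mathbf x:\ \mathbf x\in\mathbb R^n,\ \mathbf z\in\{0,1\}^n,\ x_i(1-z_i)=0\ \forall i\in\{1,\dots,n\}\Big\}.$$ There exists a constant $C$ that depends only on the bandwidth $k$ and the minimum and maximum eigenvalues of $\mathbf Q$ such that, for every $\varepsilon>0$, the shortest path between the root and a terminal node in an $m$-truncated decision diagram with $$m=\left\lceil\frac{k}{|\log(\gamma)|}\log\left(\frac{C\|\mathbf d\|_\infty^2 n}{\varepsilon}\right)\right\rceil$$ (arc lengths as defined in the context) has length $h_m^*$ such that $|h_m^*-h^*|\le\varepsilon$.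
   Context: Notation: $\gamma=\frac{\sqrt{\mathrm{cond}(\mathbf Q)}-1}{\sqrt{\mathrm{cond}(\mathbf Q)}+1}$, where $\mathrm{cond}(\mathbf Q)$ is the ratio of the largest to the smallest eigenvalue of $\mathbf Q$. $\mathbf e_\ell$ is the $\ell$-th standard basis vector and $\mathbf Q_\ell$ the $\ell$-th column of $\mathbf Q$. Conventions: when $\gamma=0$, $k/|\log\gamma|$ is read as $0$ (and $m$ as $0$), and $m$ is read as $0$ if the displayed expression is negative or if $\mathbf d=\mathbf 0$. Transition vector and transition function: for an $n\times n$ matrix $\bar{\mathbf W}$ stored by a node in layer $\ell\in\{1,\dots,n\}$, let $$\mathbf u(\bar{\mathbf W},\ell)=\frac{1}{\sqrt{Q_{\ell\ell}-\mathbf Q_\ell^\top\bar{\mathbf W}\mathbf Q_\ell}}\left(-\bar{\mathbf W}\mathbf Q_\ell+\mathbf e_\ell\right),$$ and let $\phi_{\rm full}(\bar{\mathbf W},0)=\bar{\mathbf W}$, $\phi_{\rm full}(\bar{\mathbf W},1)=\bar{\mathbf W}+\mathbf u(\bar{\mathbf W},\ell)\mathbf u(\bar{\mathbf W},\ell)^\top$. $m$-truncated decision diagram ($m\ge 0$ an integer): a layered directed acyclic (multi)graph with layers $1,\dots,n+1$, constructed layer by layer. Layer 1 contains only the root, which stores $\mathbf 0_{n\times n}$. From each node in layer $\ell\le n$, storing $\bar{\mathbf W}$, there emanate two arcs $a$ to layer $\ell+1$, with value assignments $\nu_a=0$ and $\nu_a=1$ (the value given to $z_\ell$), leading to states $\phi_{\rm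 full}(\bar{\mathbf W},\nu_a)$; the transition vector of the arc is $\mathbf u_a=\mathbf 0$ if $\nu_a=0$ and $\mathbf u_a=\mathbf u(\bar{\mathbf W},\ell)$ if $\nu_a=1$. After generating a layer $\ell$, all states that coincide in the most recent $m$ value assignments (i.e. in the values given to $z_{\ell-m},\dots,z_{\ell-1}$, or to all of $z_1,\dots,z_{\ell-1}$ if $\ell-1\le m$) are merged into a single node, and the merged node stores the matrix of the representative state whose value assignments in the first $\ell-1-m$ layers are all zero. Nodes in layer $n+1$ are the terminal nodes. The length of an arc $a$ emanating from layer $\ell(a)$ is $l_a=c_{\ell(a)}\nu_a-\frac12(\mathbf d^\top\mathbf u_a)^2$, and the length of a path is the sum of its arc lengths. *)

theory Defs
  imports
    "Jordan_Normal_Form.Spectral_Radius"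
    "Graph_Theory.Arc_Walk"
begin

text \<open>
  Coordinates, columns and layers are numbered from \<open>0\<close>: layer \<open>i\<close> below
  (\<open>0 \<le> i \<le> n\<close>) is layer \<open>i + 1\<close> of the usual \<open>1\<close>-based numbering, and the arcs leaving
  it decide coordinate \<open>i\<close> of \<open>z\<close>.
\<close>

subsection \<open>The quadratic program with indicators\<close>

definition sym_pos_def :: "nat \<Rightarrow> real mat \<Rightarrow> bool" where
  "sym_pos_def n Q \<longleftrightarrow> Q \<in> carrier_mat n n \<and> transpose_mat Q = Q \<and>
     (\<forall>x \<in> carrier_vec n. x \<noteq> 0\<^sub>v n \<longrightarrow> 0 < x \<bullet> (Q *\<^sub>v x))"

definition has_bandwidth :: "nat \<Rightarrow> nat \<Rightarrow> real mat \<Rightarrow> bool" where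
  "has_bandwidth n k Q \<longleftrightarrow> (\<forall>i<n. \<forall>j<n. \<bar>int i - int j\<bar> > int k \<longrightarrow> Q $$ (i, j) = 0)"

definition objective :: "real mat \<Rightarrow> real vec \<Rightarrow> real vec \<Rightarrow> real vec \<times> real vec \<Rightarrow> real" where
  "objective Q c d = (\<lambda>(x, z). d \<bullet> x + c \<bullet> z + 1 / 2 * (x \<bullet> (Q *\<^sub>v x)))"

definition feasible :: "nat \<Rightarrow> (real vec \<times> real vec) set" where
  "feasible n = {(x, z). x \<in> carrier_vec n \<and> z \<in> carrier_vec n \<and>
     (\<forall>i<n. z $ i \<in> {0, 1}) \<and> (\<forall>i<n. x $ i * (1 - z $ i) = 0)}"

definition is_minimum :: "real set \<Rightarrow> real \<Rightarrow> bool" where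
  "is_minimum S h \<longleftrightarrow> h \<in> S \<and> (\<forall>s\<in>S. h \<le> s)"

definition is_optimal_value :: "nat \<Rightarrow> real mat \<Rightarrow> real vec \<Rightarrow> real vec \<Rightarrow> real \<Rightarrow> bool" where
  "is_optimal_value n Q c d h \<longleftrightarrow> is_minimum (objective Q c d ` feasible n) h"

subsection \<open>Truncated decision diagrams\<close>

definition transition_vec :: "real mat \<Rightarrow> real mat \<Rightarrow> nat \<Rightarrow> real vec" where
  "transition_vec Q W l =
     (1 / sqrt (Q $$ (l, l) - col Q l \<bullet> (W *\<^sub>v col Q l))) \<cdot>\<^sub>v
       (- (W *\<^sub>v col Q l) + unit_vec (dim_row Q) l)"

definition outer_prod :: "real vec \<Rightarrow> real vec \<Rightarrow> real mat" where
  "outer_prod u v = mat (dim_vec u) (dim_vec v) (\<lambda>(i, j). u $ i * v $ j)"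

definition phi_full :: "real mat \<Rightarrow> real mat \<Rightarrow> nat \<Rightarrow> bool \<Rightarrow> real mat" where
  "phi_full Q W l b =
     (if b then W + outer_prod (transition_vec Q W l) (transition_vec Q W l) else W)"

text \<open>
  A node (or a state not yet merged) consists of a word of value assignments and of the stored
  matrix. In layer \<open>i\<close> the word has length \<open>i\<close>; for a merged node it is the word of the
  representative state.
\<close>

type_synonym dd_node = "bool list \<times> real mat"

definition dd_state :: "real mat \<Rightarrow> dd_node \<Rightarrow> bool \<Rightarrow> dd_node" where
  "dd_state Q v b = (fst v @ [b], phi_full Q (snd v) (length (fst v)) b)"

definition dd_states :: "real mat \<Rightarrow> dd_node set \<Rightarrow> dd_node set" where
  "dd_states Q L = {dd_state Q v b | v b. v \<in> L}"

text \<open>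
  Natural subtraction is truncated, so for words of length at most \<open>m\<close> the next two definitions
  compare the whole words and impose no condition, respectively.
\<close>

definition same_recent :: "nat \<Rightarrow> bool list \<Rightarrow> bool list \<Rightarrow> bool" where
  "same_recent m p q \<longleftrightarrow>
     length p = length q \<and> drop (length p - m) p = drop (length q - m) q"

definition old_values_zero :: "nat \<Rightarrow> bool list \<Rightarrow> bool" where
  "old_values_zero m p \<longleftrightarrow> (\<forall>b \<in> set (take (length p - m) p). \<not> b)"

definition dd_merge :: "nat \<Rightarrow> dd_node set \<Rightarrow> dd_node \<Rightarrow> dd_node" where
  "dd_merge m S s = (THE r. r \<in> S \<and> same_recent m (fst s) (fst r) \<and> old_values_zero m (fst r))"

primrec dd_layer :: "real mat \<Rightarrow> nat \<Rightarrow> nat \<Rightarrow> dd_node set" where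
  "dd_layer Q m 0 = {([], 0\<^sub>m (dim_row Q) (dim_row Q))}"
| "dd_layer Q m (Suc i) =
     dd_merge m (dd_states Q (dd_layer Q m i)) ` dd_states Q (dd_layer Q m i)"

definition dd_root :: "nat \<Rightarrow> dd_node" where
  "dd_root n = ([], 0\<^sub>m n n)"

text \<open>An arc is given by its tail and its value assignment, so parallel arcs are possible.\<close>

definition truncated_dd :: "nat \<Rightarrow> real mat \<Rightarrow> nat \<Rightarrow> (dd_node, dd_node \<times> bool) pre_digraph" where
  "truncated_dd n Q m =
     \<lparr> verts = (\<Union>i\<le>n. dd_layer Q m i),
       arcs = {(v, b). \<exists>i<n. v \<in> dd_layer Q m i},
       tail = fst,
       head = (\<lambda>(v, b).
         dd_merge m (dd_states Q (dd_layer Q m (length (fst v)))) (dd_state Q v b)) \<rparr>"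

definition arc_vec :: "real mat \<Rightarrow> dd_node \<times> bool \<Rightarrow> real vec" where
  "arc_vec Q = (\<lambda>(v, b).
     if b then transition_vec Q (snd v) (length (fst v)) else 0\<^sub>v (dim_row Q))"

definition arc_length :: "real mat \<Rightarrow> real vec \<Rightarrow> real vec \<Rightarrow> dd_node \<times> bool \<Rightarrow> real" where
  "arc_length Q c d = (\<lambda>(v, b).
     c $ length (fst v) * of_bool b - 1 / 2 * (d \<bullet> arc_vec Q (v, b))\<^sup>2)"

definition is_shortest_path_length ::
    "nat \<Rightarrow> real mat \<Rightarrow> real vec \<Rightarrow> real vec \<Rightarrow> nat \<Rightarrow> real \<Rightarrow> bool" where
  "is_shortest_path_length n Q c d m h \<longleftrightarrow>
     is_minimum
       {sum_list (map (arc_length Q c d) p) | p t.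
          t \<in> dd_layer Q m n \<and> pre_digraph.apath (truncated_dd n Q m) (dd_root n) p t} h"

text \<open>
  The definite description in \<^const>\<open>dd_merge\<close> is always well defined: the states generated
  from a layer contain exactly one representative of each class.
\<close>

lemma dd_merge_unique_aux:
  assumes inj: "inj_on fst L"
    and words: "fst ` L = {p. length p = i \<and> old_values_zero m p}"
    and s: "s \<in> dd_states Q L"
  shows "\<exists>!r. r \<in> dd_states Q L \<and> same_recent m (fst s) (fst r) \<and> old_values_zero m (fst r)"
proof -
  define q where "q = fst s"
  have len: "length q = Suc i"
  proof -
    obtain v b where vb: "v \<in> L" "s = dd_state Q v b" using s by (auto simp: dd_states_def)
    have "length (fst v) = i" using words vb(1) by blast
    then show ?thesis using vb by (simp add: q_def dd_state_def)
  qed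
  define r where "r = replicate (Suc i - m) False @ drop (Suc i - m) q"
  have lr: "length r = Suc i" using len by (simp add: r_def)
  have tr: "take (Suc i - m) r = replicate (Suc i - m) False" by (simp add: r_def)
  have dr: "drop (Suc i - m) r = drop (Suc i - m) q" by (simp add: r_def)
  have oz: "old_values_zero m r" using lr tr by (simp add: old_values_zero_def)
  have rne: "r = butlast r @ [last r]" using lr by (metis append_butlast_last_id list.size(3) nat.simps(3))
  have "take (i - m) (butlast r) = take (i - m) (take (Suc i - m) r)"
    using lr by (simp add: butlast_conv_take)
  then have "old_values_zero m (butlast r)"
    using lr tr by (simp add: old_values_zero_def)
  then have "butlast r \<in> fst ` L" using words lr by simp
  then obtain v where v: "v \<in> L" "fst v = butlast r" by auto
  have mem: "dd_state Q v (last r) \<in> dd_states Q L" unfolding dd_states_def using v(1) by blast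
  have fr: "fst (dd_state Q v (last r)) = r" using v rne by (simp add: dd_state_def)
  show ?thesis
  proof (rule ex1I[of _ "dd_state Q v (last r)"])
    show "dd_state Q v (last r) \<in> dd_states Q L \<and>
        same_recent m (fst s) (fst (dd_state Q v (last r))) \<and>
        old_values_zero m (fst (dd_state Q v (last r)))"
      using mem fr oz lr dr len by (simp add: same_recent_def q_def)
  next
    fix t assume t: "t \<in> dd_states Q L \<and> same_recent m (fst s) (fst t) \<and> old_values_zero m (fst t)"
    then obtain w b where w: "w \<in> L" "t = dd_state Q w b" by (auto simp: dd_states_def)
    have lt: "length (fst t) = Suc i" using t len by (simp add: same_recent_def q_def)
    have "drop (Suc i - m) (fst t) = drop (Suc i - m) r"
      using t dr len lt unfolding same_recent_def q_def by metis
    moreover have "take (Suc i - m) (fst t) = replicate (Suc i - m) False"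
    proof (rule replicate_eqI)
      show "length (take (Suc i - m) (fst t)) = Suc i - m" using lt by simp
    next
      fix y assume "y \<in> set (take (Suc i - m) (fst t))"
      then show "y = False" using t lt by (auto simp: old_values_zero_def)
    qed
    ultimately have ft: "fst t = r" using tr by (metis append_take_drop_id)
    then have "fst w @ [b] = butlast r @ [last r]" using w rne by (simp add: dd_state_def)
    then have wb: "fst w = fst v" "b = last r" using v by auto
    then have "w = v" using inj_onD[OF inj wb(1)] w(1) v(1) by blast
    then show "t = dd_state Q v (last r)" using w wb by simp
  qed
qed

lemma dd_layer_words:
  "inj_on fst (dd_layer Q m i) \<and>
   fst ` dd_layer Q m i = {p. length p = i \<and> old_values_zero m p}"
proof (induction i)
  case 0
  show ?case by (auto simp: old_values_zero_def)
next
  case (Suc i)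
  let ?S = "dd_states Q (dd_layer Q m i)"
  have m: "dd_merge m ?S s \<in> ?S \<and> same_recent m (fst s) (fst (dd_merge m ?S s)) \<and>
      old_values_zero m (fst (dd_merge m ?S s))" if "s \<in> ?S" for s
    unfolding dd_merge_def by (rule theI', rule dd_merge_unique_aux) (use Suc that in auto)
  have id: "dd_merge m ?S s = s" if "s \<in> ?S" "old_values_zero m (fst s)" for s
    unfolding dd_merge_def
    by (rule the1_equality[OF dd_merge_unique_aux[OF conjunct1[OF Suc] conjunct2[OF Suc] that(1)]])
      (use that in \<open>simp add: same_recent_def\<close>)
  have lay: "dd_layer Q m (Suc i) = {s \<in> ?S. old_values_zero m (fst s)}"
  proof (rule equalityI; rule subsetI)
    fix x assume "x \<in> dd_layer Q m (Suc i)"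
    then show "x \<in> {s \<in> ?S. old_values_zero m (fst s)}" using m by auto
  next
    fix x assume "x \<in> {s \<in> ?S. old_values_zero m (fst s)}"
    then show "x \<in> dd_layer Q m (Suc i)" using id[of x] image_eqI[of x "dd_merge m ?S" x ?S] by simp
  qed
  have "inj_on fst ?S"
  proof (rule inj_onI)
    fix x y assume "x \<in> ?S" "y \<in> ?S" and e: "fst x = fst y"
    then obtain v b w c where vw: "v \<in> dd_layer Q m i" "x = dd_state Q v b"
      "w \<in> dd_layer Q m i" "y = dd_state Q w c" unfolding dd_states_def by blast
    have "fst v = fst w" "b = c" using e vw by (auto simp: dd_state_def)
    moreover have "v = w" using inj_onD[OF conjunct1[OF Suc]] calculation(1) vw(1,3) by blast
    ultimately show "x = y" using vw by simp
  qed
  then have 1: "inj_on fst (dd_layer Q m (Suc i))" unfolding lay by (rule inj_on_subset) auto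
  have 2: "fst ` ?S = {p @ [b] | p b. length p = i \<and> old_values_zero m p}"
  proof -
    have "fst ` ?S = {fst v @ [b] | v b. v \<in> dd_layer Q m i}"
    proof (rule equalityI; rule subsetI)
      fix x assume "x \<in> fst ` ?S"
      then show "x \<in> {fst v @ [b] | v b. v \<in> dd_layer Q m i}"
        unfolding dd_states_def dd_state_def by auto
    next
      fix x assume "x \<in> {fst v @ [b] | v b. v \<in> dd_layer Q m i}"
      then obtain v b where v: "v \<in> dd_layer Q m i" "x = fst (dd_state Q v b)"
        by (auto simp: dd_state_def)
      then have "dd_state Q v b \<in> ?S" unfolding dd_states_def by blast
      then show "x \<in> fst ` ?S" unfolding v(2) by (rule imageI)
    qed
    also have "\<dots> = {p @ [b] | p b. p \<in> fst ` dd_layer Q m i}" by blast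
    finally show ?thesis unfolding conjunct2[OF Suc] by simp
  qed
  have 3: "\<exists>p b. q = p @ [b] \<and> length p = i \<and> old_values_zero m p"
    if "length q = Suc i" "old_values_zero m q" for q
  proof (intro exI conjI)
    show "q = butlast q @ [last q]" using that by (metis append_butlast_last_id list.size(3) nat.simps(3))
    show "length (butlast q) = i" using that by simp
    have "set (take (i - m) (butlast q)) \<subseteq> set (take (Suc i - m) q)"
      using that by (simp add: butlast_conv_take set_take_subset_set_take)
    then show "old_values_zero m (butlast q)" using that by (auto simp: old_values_zero_def)
  qed
  have "fst ` dd_layer Q m (Suc i) = fst ` ?S \<inter> {p. old_values_zero m p}" unfolding lay by auto
  also have "\<dots> = {p. length p = Suc i \<and> old_values_zero m p}" unfolding 2 using 3 by auto
  finally show ?case using 1 by simp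
qed

lemma dd_merge_unique:
  assumes "s \<in> dd_states Q (dd_layer Q m i)"
  shows "\<exists>!r. r \<in> dd_states Q (dd_layer Q m i) \<and>
    same_recent m (fst s) (fst r) \<and> old_values_zero m (fst r)"
  by (rule dd_merge_unique_aux[OF conjunct1[OF dd_layer_words] conjunct2[OF dd_layer_words] assms])

subsection \<open>The truncation depth\<close>

definition cond_number :: "real mat \<Rightarrow> real" where
  "cond_number Q = Max (spectrum Q) / Min (spectrum Q)"

definition decay_rate :: "real mat \<Rightarrow> real" where
  "decay_rate Q = (sqrt (cond_number Q) - 1) / (sqrt (cond_number Q) + 1)"

definition linf_norm :: "real vec \<Rightarrow> real" where
  "linf_norm d = Max ((\<lambda>i. \<bar>d $ i\<bar>) ` {..<dim_vec d})"

definition truncation_depth ::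
    "nat \<Rightarrow> nat \<Rightarrow> real mat \<Rightarrow> real vec \<Rightarrow> real \<Rightarrow> real \<Rightarrow> nat" where
  "truncation_depth n k Q d C \<epsilon> =
     (if decay_rate Q = 0 \<or> d = 0\<^sub>v n then 0
      else nat \<lceil>real k / \<bar>ln (decay_rate Q)\<bar> * ln (C * (linf_norm d)\<^sup>2 * real n / \<epsilon>)\<rceil>)"

end

theory Submission
  imports Defs
begin

text \<open>
  The nodes store zero-padded inverses of principal submatrices of \<open>Q\<close>, so the \<open>n\<close>-truncated
  diagram is exact, and cutting off the old assignments only replaces, for each arc, the set
  \<open>T\<close> of active indices up to \<open>i\<close> by its window \<open>T'\<close> of the last \<open>m\<close> indices. The squared
  term of the arc is \<open>(d \<bullet> v)\<^sup>2 / v\<^sub>i\<close>, where \<open>v\<close> is the \<open>i\<close>-th column of the inverse of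
  the submatrix of \<open>Q\<close> on \<open>T\<close>. Both \<open>v\<close> and the change of \<open>v\<close> from \<open>T\<close> to \<open>T'\<close> solve systems
  with a banded matrix and a localised right-hand side \<open>f\<close>, and such solutions decay like
  \<open>\<gamma>\<close> to the power (distance to the support of \<open>f\<close>) \<open>/ k\<close>.

  The decay needs no spectral theorem. With \<open>B\<close> the affine image of \<open>Q\<close> whose spectrum lies in
  \<open>[-1, 1]\<close>, the vector \<open>T\<^sub>N(B) v\<close> (Chebyshev polynomial of the first kind) agrees with
  \<open>T\<^sub>N(\<sigma>) v\<close>, \<open>\<sigma> = (b + a) / (b - a)\<close>, at distance more than \<open>k (N - 1)\<close> from the support of
  \<open>f\<close>; its norm is at most that of \<open>v\<close>, while \<open>T\<^sub>N(\<sigma>) = (\<gamma>\<^sup>N + \<gamma>\<^sup>-\<^sup>N) / 2\<close>.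
\<close>

subsection \<open>Chebyshev polynomials and decay for banded systems\<close>

text \<open>Vectors are functions that are read only on the index set, so passing to a principal
  submatrix just changes \<open>T\<close> and needs no renumbering.\<close>

definition ip :: "'a set \<Rightarrow> ('a \<Rightarrow> real) \<Rightarrow> ('a \<Rightarrow> real) \<Rightarrow> real" where
  "ip T f g = (\<Sum>i\<in>T. f i * g i)"

definition app :: "'a set \<Rightarrow> ('a \<Rightarrow> 'a \<Rightarrow> real) \<Rightarrow> ('a \<Rightarrow> real) \<Rightarrow> 'a \<Rightarrow> real" where
  "app T Q f = (\<lambda>i. \<Sum>j\<in>T. Q i j * f j)"

lemma ip_commute: "ip T f g = ip T g f"
  by (simp add: ip_def mult.commute)

lemma ip_add_right: "ip T f (\<lambda>i. g i + h i) = ip T f g + ip T f h"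
  by (simp add: ip_def distrib_left sum.distrib)

lemma ip_diff_right: "ip T f (\<lambda>i. g i - h i) = ip T f g - ip T f h"
  by (simp add: ip_def right_diff_distrib sum_subtractf)

lemma ip_scale_right: "ip T f (\<lambda>i. s * g i) = s * ip T f g"
  by (simp add: ip_def sum_distrib_left algebra_simps)

lemma ip_add_left: "ip T (\<lambda>i. g i + h i) f = ip T g f + ip T h f"
  by (simp add: ip_def distrib_right sum.distrib)

lemma ip_diff_left: "ip T (\<lambda>i. g i - h i) f = ip T g f - ip T h f"
  by (simp add: ip_def left_diff_distrib sum_subtractf)

lemma ip_scale_left: "ip T (\<lambda>i. s * g i) f = s * ip T g f"
  by (simp add: ip_def sum_distrib_left algebra_simps)

lemma app_add: "app T Q (\<lambda>i. g i + h i) = (\<lambda>i. app T Q g i + app T Q h i)"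
  by (simp add: app_def distrib_left sum.distrib)

lemma app_diff: "app T Q (\<lambda>i. g i - h i) = (\<lambda>i. app T Q g i - app T Q h i)"
  by (simp add: app_def right_diff_distrib sum_subtractf)

lemma app_scale: "app T Q (\<lambda>i. s * g i) = (\<lambda>i. s * app T Q g i)"
  by (simp add: app_def sum_distrib_left algebra_simps)

lemmas ip_linear = ip_add_right ip_diff_right ip_scale_right ip_add_left ip_diff_left ip_scale_left
  app_add app_diff app_scale

lemma ip_nonneg: "0 \<le> ip T f f"
  by (simp add: ip_def sum_nonneg)

lemma ip_app_commute:
  assumes "\<And>i j. i \<in> T \<Longrightarrow> j \<in> T \<Longrightarrow> Q i j = Q j i"
  shows "ip T x (app T Q y) = ip T (app T Q x) y"
proof -
  have "ip T x (app T Q y) = (\<Sum>i\<in>T. \<Sum>j\<in>T. x i * Q i j * y j)"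
    by (simp add: ip_def app_def sum_distrib_left algebra_simps)
  also have "\<dots> = (\<Sum>j\<in>T. \<Sum>i\<in>T. x i * Q i j * y j)" by (rule sum.swap)
  also have "\<dots> = ip T (app T Q x) y"
    unfolding ip_def app_def sum_distrib_right
    by (intro sum.cong refl) (use assms in \<open>simp add: algebra_simps\<close>)
  finally show ?thesis .
qed

text \<open>With \<open>y = app T B x\<close>, adding the upper bound at \<open>x + y\<close> and
  the lower bound at \<open>x - y\<close> cancels the terms in \<open><x, y>\<close> and
  \<open><y, B y>\<close> and leaves \<open>4 |y|^2 <= 2 |x|^2 + 2 |y|^2\<close>.\<close>

lemma form_bound_imp_contraction:
  assumes sym: "\<And>i j. i \<in> T \<Longrightarrow> j \<in> T \<Longrightarrow> B i j = B j i"
    and ub: "\<And>x. ip T x (app T B x) \<le> ip T x x"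
    and lb: "\<And>x. - ip T x x \<le> ip T x (app T B x)"
  shows "ip T (app T B x) (app T B x) \<le> ip T x x"
proof -
  define y where "y = app T B x"
  have y: "app T B x = y" by (simp add: y_def)
  have s: "ip T x (app T B y) = ip T y y"
    using ip_app_commute[of T B x y] sym y by simp
  have "ip T (\<lambda>i. x i + y i) (app T B (\<lambda>i. x i + y i)) \<le> ip T (\<lambda>i. x i + y i) (\<lambda>i. x i + y i)"
    by (rule ub)
  moreover have "- ip T (\<lambda>i. x i - y i) (\<lambda>i. x i - y i) \<le> ip T (\<lambda>i. x i - y i) (app T B (\<lambda>i. x i - y i))"
    by (rule lb)
  ultimately show ?thesis
    unfolding y by (simp add: ip_linear y s ip_commute[of T y x])
qed

text \<open>
  \<open>cheb\<close> and \<open>cheb2\<close> apply the Chebyshev polynomials of the first and second kind of \<open>B\<close> to \<open>v\<close>.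
  The contraction property of the first kind follows from \<open>T\<^sub>N\<^sub>+\<^sub>1 = U\<^sub>N\<^sub>+\<^sub>1 - x U\<^sub>N\<close> and the
  quantity conserved by the recursion of the second kind.
\<close>

fun cheb :: "'a set \<Rightarrow> ('a \<Rightarrow> 'a \<Rightarrow> real) \<Rightarrow> ('a \<Rightarrow> real) \<Rightarrow> nat \<Rightarrow> 'a \<Rightarrow> real" where
  "cheb T B v 0 = v"
| "cheb T B v (Suc 0) = app T B v"
| "cheb T B v (Suc (Suc N)) = (\<lambda>i. 2 * app T B (cheb T B v (Suc N)) i - cheb T B v N i)"

fun cheb2 :: "'a set \<Rightarrow> ('a \<Rightarrow> 'a \<Rightarrow> real) \<Rightarrow> ('a \<Rightarrow> real) \<Rightarrow> nat \<Rightarrow> 'a \<Rightarrow> real" where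
  "cheb2 T B v 0 = v"
| "cheb2 T B v (Suc 0) = (\<lambda>i. 2 * app T B v i)"
| "cheb2 T B v (Suc (Suc N)) = (\<lambda>i. 2 * app T B (cheb2 T B v (Suc N)) i - cheb2 T B v N i)"

lemma cheb_eq_cheb2:
  "cheb T B v (Suc N) = (\<lambda>i. cheb2 T B v (Suc N) i - app T B (cheb2 T B v N) i)"
proof (induction N rule: induct_nat_012)
  case 0
  show ?case by simp
next
  case 1
  show ?case by (simp add: ip_linear algebra_simps fun_eq_iff)
next
  case (ge2 N)
  have "cheb T B v (Suc (Suc (Suc N))) =
      (\<lambda>i. 2 * app T B (cheb T B v (Suc (Suc N))) i - cheb T B v (Suc N) i)" by simp
  also have "\<dots> = (\<lambda>i. cheb2 T B v (Suc (Suc (Suc N))) i - app T B (cheb2 T B v (Suc (Suc N))) i)"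
    unfolding ge2 cheb2.simps(3)[of _ _ _ "Suc N"]
    by (simp add: ip_linear algebra_simps fun_eq_iff)
  finally show ?case .
qed

text \<open>The polynomial identity \<open>U_{N+1}^2 - 2 x U_{N+1} U_N + U_N^2 = 1\<close>, with
  \<open>B\<close> in place of \<open>x\<close>.\<close>

lemma cheb2_energy:
  fixes v :: "'a \<Rightarrow> real"
  assumes sym: "\<And>i j. i \<in> T \<Longrightarrow> j \<in> T \<Longrightarrow> B i j = B j i"
  defines "u \<equiv> cheb2 T B v"
  shows "ip T (u (Suc N)) (u (Suc N)) - 2 * ip T (u (Suc N)) (app T B (u N)) + ip T (u N) (u N) = ip T v v"
proof (induction N)
  case 0
  show ?case by (simp add: u_def ip_linear)
next
  case (Suc N)
  have e: "app T B (u (Suc N)) = (\<lambda>i. (1 / 2) * (u (Suc (Suc N)) i + u N i))"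
    by (simp add: u_def)
  have h: "ip T f (app T B (u (Suc N))) = (ip T f (u (Suc (Suc N))) + ip T f (u N)) / 2" for f
    unfolding e ip_scale_right ip_add_right by simp
  have "ip T (u (Suc N)) (app T B (u N)) = ip T (u N) (app T B (u (Suc N)))"
    using ip_app_commute[of T B] sym by (metis ip_commute)
  then show ?case using Suc
    by (simp add: h ip_commute[of T "u N" "u (Suc (Suc N))"] field_simps)
qed

text \<open>For \<open>u = cheb2 T B v N\<close> the conserved quantity gives
  \<open>|v|^2 - (|u|^2 - |B u|^2)\<close> as the squared norm of \<open>cheb T B v (Suc N)\<close>,
  and \<open>B\<close> is a contraction.\<close>

lemma cheb_contraction:
  assumes sym: "\<And>i j. i \<in> T \<Longrightarrow> j \<in> T \<Longrightarrow> B i j = B j i"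
    and ub: "\<And>x. ip T x (app T B x) \<le> ip T x x"
    and lb: "\<And>x. - ip T x x \<le> ip T x (app T B x)"
  shows "ip T (cheb T B v N) (cheb T B v N) \<le> ip T v v"
proof (cases N)
  case (Suc N)
  have "ip T (app T B (cheb2 T B v N)) (app T B (cheb2 T B v N)) \<le> ip T (cheb2 T B v N) (cheb2 T B v N)"
    by (rule form_bound_imp_contraction[OF assms])
  with cheb2_energy[of T B v N, OF sym] show ?thesis
    unfolding Suc cheb_eq_cheb2
    by (simp add: ip_linear ip_commute[of T "app T B (cheb2 T B v N)" "cheb2 T B v (Suc N)"])
qed simp

text \<open>The value of the \<open>N\<close>-th Chebyshev polynomial at \<open>(q + 1 / q) / 2\<close>.\<close>

definition tau :: "real \<Rightarrow> nat \<Rightarrow> real" where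
  "tau q N = (q ^ N + (1 / q) ^ N) / 2"

lemma tau_rec:
  assumes "q \<noteq> 0"
  shows "tau q (Suc (Suc N)) = 2 * tau q 1 * tau q (Suc N) - tau q N"
  using assms by (simp add: tau_def field_simps)

text \<open>Off \<open>F\<close>, \<open>v\<close> looks like an eigenvector of \<open>B\<close> for
  \<open>tau q 1\<close>. The first application of \<open>B\<close> spoils nothing outside
  \<open>F\<close>, and each further one spreads the damage by at most \<open>k\<close> indices;
  hence the factor \<open>N - 1\<close>.\<close>

lemma cheb_away:
  fixes B :: "nat \<Rightarrow> nat \<Rightarrow> real"
  assumes q: "q \<noteq> 0"
    and band: "\<And>i j. i \<in> T \<Longrightarrow> j \<in> T \<Longrightarrow> \<bar>int i - int j\<bar> > int k \<Longrightarrow> B i j = 0"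
    and eq: "\<And>i. i \<in> T \<Longrightarrow> i \<notin> F \<Longrightarrow> app T B v i = tau q 1 * v i"
    and "i \<in> T" "\<And>l. l \<in> F \<Longrightarrow> int k * (int N - 1) < \<bar>int i - int l\<bar>"
  shows "cheb T B v N i = tau q N * v i"
  using assms(4,5)
proof (induction N arbitrary: i rule: induct_nat_012)
  case 0
  show ?case by (simp add: tau_def)
next
  case 1
  have "i \<notin> F" using 1(2)[of i] by auto
  then show ?case using eq 1 by simp
next
  case (ge2 N)
  have F: "i \<notin> F"
  proof
    assume "i \<in> F"
    from ge2.prems(2)[OF this] show False by (simp add: zero_less_mult_iff mult_less_0_iff)
  qed
  \<comment> \<open>Only indices within distance \<open>k\<close> enter row \<open>i\<close>, and
    these are still farther than \<open>k * N\<close> from \<open>F\<close>.\<close>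
  have nb: "cheb T B v (Suc N) j = tau q (Suc N) * v j" if "j \<in> T" "B i j \<noteq> 0" for j
  proof (rule ge2.IH(2)[OF that(1)])
    fix l assume "l \<in> F"
    from ge2.prems(2)[OF this] have "int k + int k * int N < \<bar>int i - int l\<bar>" by (simp add: algebra_simps)
    moreover have "\<bar>int i - int j\<bar> \<le> int k" using band[OF ge2.prems(1) that(1)] that(2) by force
    ultimately show "int k * (int (Suc N) - 1) < \<bar>int j - int l\<bar>" by simp
  qed
  have 1: "app T B (cheb T B v (Suc N)) i = tau q (Suc N) * app T B v i"
    unfolding app_def sum_distrib_left
  proof (intro sum.cong refl)
    fix j assume "j \<in> T"
    then show "B i j * cheb T B v (Suc N) j = tau q (Suc N) * (B i j * v j)"
      using nb by (cases "B i j = 0") auto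
  qed
  have 2: "cheb T B v N i = tau q N * v i"
  proof (rule ge2.IH(1)[OF ge2.prems(1)])
    fix l assume "l \<in> F"
    from ge2.prems(2)[OF this] show "int k * (int N - 1) < \<bar>int i - int l\<bar>"
      by (simp add: algebra_simps)
  qed
  show ?case
    unfolding cheb.simps 1 2 eq[OF ge2.prems(1) F] tau_rec[OF q] by (simp add: algebra_simps)
qed

text \<open>\<open>a\<close> and \<open>b\<close> are just bounds for the form, so that principal
  submatrices can share them. The \<open>k\<close>-th root \<open>r\<close> of \<open>q\<close>
  measures decay per index instead of per block of \<open>k\<close> indices.\<close>

locale banded_form =
  fixes T :: "nat set" and Q :: "nat \<Rightarrow> nat \<Rightarrow> real" and a b :: real and k :: nat and q r :: real
  assumes fin: "finite T"
    and sym: "\<And>i j. i \<in> T \<Longrightarrow> j \<in> T \<Longrightarrow> Q i j = Q j i"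
    and lower: "\<And>x. a * ip T x x \<le> ip T x (app T Q x)"
    and upper: "\<And>x. ip T x (app T Q x) \<le> b * ip T x x"
    and band: "\<And>i j. i \<in> T \<Longrightarrow> j \<in> T \<Longrightarrow> \<bar>int i - int j\<bar> > int k \<Longrightarrow> Q i j = 0"
    and k: "1 \<le> k"
    and ab: "0 < a" "a < b"
    and q: "0 < q" "q < 1" "tau q 1 = (b + a) / (b - a)"
    and r: "0 < r" "r ^ k = q"
begin

lemma r1: "r < 1"
  using r q by (metis linorder_not_le one_le_power)

text \<open>The affine map sends \<open>[a, b]\<close> to \<open>[-1, 1]\<close> and reverses it:
  where \<open>Q v\<close> vanishes, \<open>B\<close> multiplies \<open>v\<close> by
  \<open>tau q 1\<close>, which exceeds 1.\<close>

definition B :: "nat \<Rightarrow> nat \<Rightarrow> real" where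
  "B i j = (if i = j then tau q 1 else 0) - 2 / (b - a) * Q i j"

lemma app_B:
  assumes "i \<in> T"
  shows "app T B x i = tau q 1 * x i - 2 / (b - a) * app T Q x i"
proof -
  have "app T B x i = (\<Sum>j\<in>T. (if i = j then tau q 1 * x j else 0) - 2 / (b - a) * (Q i j * x j))"
    unfolding app_def B_def by (intro sum.cong refl) (auto simp: algebra_simps)
  also have "\<dots> = tau q 1 * x i - 2 / (b - a) * app T Q x i"
    using assms fin by (simp add: sum_subtractf sum_distrib_left app_def)
  finally show ?thesis .
qed

lemma ip_app_B: "ip T x (app T B x) = tau q 1 * ip T x x - 2 / (b - a) * ip T x (app T Q x)"
proof -
  have "ip T x (app T B x) = ip T x (\<lambda>i. tau q 1 * x i - 2 / (b - a) * app T Q x i)"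
    unfolding ip_def by (intro sum.cong refl) (simp add: app_B)
  then show ?thesis by (simp only: ip_diff_right ip_scale_right)
qed

lemma B_upper: "ip T x (app T B x) \<le> ip T x x"
proof -
  have "ip T x (app T B x) = ((b + a) * ip T x x - 2 * ip T x (app T Q x)) / (b - a)"
    unfolding ip_app_B q(3) by (simp add: diff_divide_distrib)
  also have "\<dots> \<le> ip T x x"
    using ab lower[of x] by (simp add: pos_divide_le_eq algebra_simps)
  finally show ?thesis .
qed

lemma B_lower: "- ip T x x \<le> ip T x (app T B x)"
proof -
  have "- ip T x x \<le> ((b + a) * ip T x x - 2 * ip T x (app T Q x)) / (b - a)"
    using ab upper[of x] by (simp add: pos_le_divide_eq algebra_simps)
  also have "\<dots> = ip T x (app T B x)"
    unfolding ip_app_B q(3) by (simp add: diff_divide_distrib)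
  finally show ?thesis .
qed

text \<open>Expand \<open>0 <= |f - a v|^2\<close> and insert \<open>a |v|^2 <= <v, f>\<close>, the
  lower form bound at \<open>v\<close>.\<close>

lemma solution_norm:
  assumes sol: "\<And>i. i \<in> T \<Longrightarrow> app T Q v i = f i"
  shows "a\<^sup>2 * ip T v v \<le> ip T f f"
proof -
  have "ip T v (app T Q v) = ip T v f" unfolding ip_def by (intro sum.cong refl) (simp add: sol)
  then have "a * ip T v v \<le> ip T v f" using lower[of v] by simp
  moreover have "0 \<le> ip T (\<lambda>i. f i - a * v i) (\<lambda>i. f i - a * v i)" by (rule ip_nonneg)
  then have "0 \<le> ip T f f - 2 * a * ip T v f + a\<^sup>2 * ip T v v"
    by (simp add: ip_linear ip_commute[of T f v] power2_eq_square algebra_simps)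
  moreover have "2 * a * (a * ip T v v) \<le> 2 * a * ip T v f"
    using calculation(1) ab by (intro mult_left_mono) auto
  ultimately show ?thesis by (simp add: power2_eq_square algebra_simps)
qed

text \<open>The entry \<open>tau q N * v j\<close> of \<open>cheb T B v N\<close> is at most the
  norm of \<open>v\<close>, hence at most \<open>M / a\<close>; and \<open>1 / tau q N\<close> is at
  most \<open>2 * q ^ N\<close>.\<close>

lemma decay:
  assumes sol: "\<And>i. i \<in> T \<Longrightarrow> app T Q v i = f i"
    and nf: "ip T f f \<le> M\<^sup>2" and M: "0 \<le> M"
    and j: "j \<in> T" and away: "\<And>l. l \<in> T \<Longrightarrow> f l \<noteq> 0 \<Longrightarrow> int D \<le> \<bar>int j - int l\<bar>"
  shows "\<bar>v j\<bar> \<le> 2 / a * r ^ D * M"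
proof -
  \<comment> \<open>This is \<open>D / k\<close> rounded up: small enough for
    \<open>k * (N - 1) < D\<close>, as \<open>cheb_away\<close> demands, and large enough for
    \<open>q ^ N <= r ^ D\<close>.\<close>
  define N where "N = (D + k - 1) div k"
  define F where "F = {l \<in> T. f l \<noteq> 0}"
  have kN: "D \<le> k * N" "k * N < D + k"
  proof -
    have "k * N + (D + k - 1) mod k = D + k - 1" unfolding N_def by simp
    moreover have "(D + k - 1) mod k < k" using k by simp
    ultimately show "D \<le> k * N" "k * N < D + k" using k by linarith+
  qed
  have c: "cheb T B v N j = tau q N * v j"
  proof (rule cheb_away[where F = F and k = k and T = T])
    show "B i l = 0" if "i \<in> T" "l \<in> T" "\<bar>int i - int l\<bar> > int k" for i l
      using that band unfolding B_def by auto
    show "app T B v i = tau q 1 * v i" if "i \<in> T" "i \<notin> F" for i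
      using that sol by (simp add: app_B F_def)
    show "int k * (int N - 1) < \<bar>int j - int l\<bar>" if "l \<in> F" for l
    proof -
      have "int D \<le> \<bar>int j - int l\<bar>" using away that by (simp add: F_def)
      moreover have "int k * int N < int D + int k" using kN(2) by (metis of_nat_add of_nat_less_iff of_nat_mult)
      ultimately show ?thesis by (simp add: algebra_simps)
    qed
  qed (use q j in auto)
  have symB: "B i l = B l i" if "i \<in> T" "l \<in> T" for i l using sym that by (simp add: B_def)
  have "(tau q N * v j)\<^sup>2 \<le> ip T (cheb T B v N) (cheb T B v N)"
    unfolding c[symmetric] ip_def power2_eq_square
    using j fin by (intro member_le_sum) auto
  also have "\<dots> \<le> ip T v v"
    by (rule cheb_contraction) (use symB B_upper B_lower in auto)
  finally have "(tau q N * v j)\<^sup>2 \<le> ip T v v" .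
  then have "a\<^sup>2 * (tau q N * v j)\<^sup>2 \<le> M\<^sup>2"
    using solution_norm[OF sol] nf by (smt (verit) mult_left_mono zero_le_power2)
  then have "(a * (tau q N * v j))\<^sup>2 \<le> M\<^sup>2" by (simp add: power_mult_distrib)
  then have "\<bar>a * (tau q N * v j)\<bar> \<le> M" using M by (metis abs_le_square_iff abs_of_nonneg)
  then have 1: "a * tau q N * \<bar>v j\<bar> \<le> M" using ab q by (simp add: abs_mult tau_def)
  have "1 \<le> 2 * q ^ N * tau q N" using q by (simp add: tau_def field_simps)
  then have "a * \<bar>v j\<bar> * 1 \<le> a * \<bar>v j\<bar> * (2 * q ^ N * tau q N)" using ab by (intro mult_left_mono) auto
  also have "\<dots> = 2 * q ^ N * (a * tau q N * \<bar>v j\<bar>)" by simp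
  also have "\<dots> \<le> 2 * q ^ N * M" using 1 q by (intro mult_left_mono) auto
  also have "\<dots> \<le> 2 * r ^ D * M"
  proof -
    have "q ^ N \<le> r ^ D" using kN(1) r r1 by (metis power_decreasing power_mult less_imp_le)
    then show ?thesis using M by (intro mult_right_mono) auto
  qed
  finally show ?thesis using ab by (simp add: field_simps)
qed

end

subsection \<open>The effect of truncation on columns of the inverse\<close>

text \<open>Distinct exponents make the sum a part of the geometric series.\<close>

lemma sum_power_inj_le:
  fixes r :: real
  assumes "finite A" "inj_on g A" "0 < r" "r < 1"
  shows "(\<Sum>j\<in>A. r ^ g j) \<le> 1 / (1 - r)"
proof -
  have "(\<Sum>j\<in>A. r ^ g j) = (\<Sum>t\<in>g ` A. r ^ t)"
    using assms by (simp add: sum.reindex)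
  also have "\<dots> \<le> (\<Sum>t. r ^ t)"
    by (rule sum_le_suminf) (use assms in \<open>auto intro: summable_geometric\<close>)
  finally show ?thesis using assms by (simp add: suminf_geometric)
qed

lemma sum_squares_le_square_sum:
  assumes "finite T"
  shows "ip T f f \<le> (\<Sum>j\<in>T. \<bar>f j\<bar>)\<^sup>2"
proof -
  have "ip T f f = (\<Sum>j\<in>T. \<bar>f j\<bar> * \<bar>f j\<bar>)" by (simp add: ip_def)
  also have "\<dots> \<le> (\<Sum>j\<in>T. \<bar>f j\<bar> * (\<Sum>j\<in>T. \<bar>f j\<bar>))"
    using assms by (intro sum_mono mult_left_mono member_le_sum) auto
  finally show ?thesis by (simp add: power2_eq_square sum_distrib_right)
qed

lemma ip_indicator:
  assumes "finite T" "i \<in> T"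
  shows "ip T (\<lambda>j. of_bool (j = i)) g = g i"
  using assms by (simp add: ip_def of_bool_def if_distrib[of "\<lambda>x. x * _"] cong: if_cong)

lemma app_indicator:
  assumes "finite T" "i \<in> T"
  shows "app T Q (\<lambda>j. of_bool (j = i)) l = Q l i"
  using assms by (simp add: app_def of_bool_def if_distrib[of "\<lambda>x. _ * x"] cong: if_cong)

text \<open>The difference splits as \<open>(X^2 - Y^2) / \<alpha> + Y^2 (\<beta> - \<alpha>) /
  (\<alpha> \<beta>)\<close>. It serves to compare the squared terms of two arcs.\<close>

lemma abs_quotient_diff_le:
  fixes X Y \<alpha> \<beta> :: real
  assumes b: "0 < b" and XY: "\<bar>X\<bar> \<le> P" "\<bar>Y\<bar> \<le> P" "\<bar>X - Y\<bar> \<le> R"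
    and ab: "1 / b \<le> \<alpha>" "1 / b \<le> \<beta>" "\<bar>\<alpha> - \<beta>\<bar> \<le> e"
  shows "\<bar>X\<^sup>2 / \<alpha> - Y\<^sup>2 / \<beta>\<bar> \<le> b * (2 * P * R) + b\<^sup>2 * (P\<^sup>2 * e)"
proof -
  have pos: "0 < \<alpha>" "0 < \<beta>" using b ab(1,2) by (smt (verit) divide_pos_pos)+
  have inv: "1 / \<alpha> \<le> b" "1 / \<beta> \<le> b" using b pos ab(1,2) by (simp_all add: field_simps)
  have P: "0 \<le> P" using XY(1) by linarith
  have "\<bar>X\<^sup>2 / \<alpha> - Y\<^sup>2 / \<beta>\<bar> = \<bar>(1 / \<alpha>) * ((X + Y) * (X - Y)) + (1 / \<alpha>) * (1 / \<beta>) * (Y\<^sup>2 * (\<beta> - \<alpha>))\<bar>"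
    using pos by (simp add: field_simps power2_eq_square)
  also have "\<dots> \<le> (1 / \<alpha>) * (\<bar>X + Y\<bar> * \<bar>X - Y\<bar>) + (1 / \<alpha>) * (1 / \<beta>) * (Y\<^sup>2 * \<bar>\<alpha> - \<beta>\<bar>)"
    by (rule order_trans[OF abs_triangle_ineq]) (use pos in \<open>simp add: abs_mult abs_minus_commute\<close>)
  also have "\<dots> \<le> b * (2 * P * R) + (b * b) * (P\<^sup>2 * e)"
  proof (intro add_mono mult_mono inv)
    show "\<bar>X + Y\<bar> \<le> 2 * P" using XY by linarith
    show "Y\<^sup>2 \<le> P\<^sup>2" using XY(2) by (metis abs_ge_zero power2_abs power_mono)
  qed (use XY ab b pos P in auto)
  finally show ?thesis by (simp add: power2_eq_square)
qed

text \<open>The geometric series with terms \<open>2 / a * r ^ t\<close>: an l1 bound for a column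
  of the inverse whose entries decay at that rate.\<close>

definition column_bound :: "real \<Rightarrow> real \<Rightarrow> real" where
  "column_bound a r = 2 / (a * (1 - r))"

text \<open>The summand 1 accounts for the entries cut off, the other one for the change inside the
  window: \<open>k * b\<close> bounds the column sums of the coupling block,
  \<open>2 / (a * (1 - r))\<close> is the summed decay, and \<open>1 / q\<close> pays for a shift by
  \<open>k\<close> indices, since \<open>r ^ k = q\<close>.\<close>

definition truncation_bound :: "real \<Rightarrow> real \<Rightarrow> nat \<Rightarrow> real \<Rightarrow> real \<Rightarrow> real" where
  "truncation_bound a b k q r = column_bound a r * (1 + 2 * k * b / (a * q * (1 - r)))"

lemma column_bound_pos: "0 < a \<Longrightarrow> r < 1 \<Longrightarrow> 0 < column_bound a r"
  by (simp add: column_bound_def)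

lemma truncation_bound_pos:
  assumes "0 < a" "0 < b" "0 < q" "r < 1"
  shows "0 < truncation_bound a b k q r"
  unfolding truncation_bound_def
proof (rule mult_pos_pos)
  show "0 < column_bound a r" using assms column_bound_pos by blast
  have "0 \<le> 2 * real k * b / (a * q * (1 - r))" using assms by simp
  then show "0 < 1 + 2 * real k * b / (a * q * (1 - r))" by linarith
qed

context banded_form
begin

text \<open>Extension by zero from \<open>S\<close> to \<open>T\<close> preserves both the norm and
  the quadratic form.\<close>

lemma subset_banded_form:
  assumes "S \<subseteq> T"
  shows "banded_form S Q a b k q r"
proof
  fix x :: "nat \<Rightarrow> real"
  define y where "y = (\<lambda>i. if i \<in> S then x i else (0::real))"
  have fS: "finite S" using assms fin finite_subset by blast
  have app_y: "app T Q y i = app S Q x i" for i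
  proof -
    have "app T Q y i = (\<Sum>j\<in>S. Q i j * y j)"
      unfolding app_def by (rule sum.mono_neutral_right) (use assms fin in \<open>auto simp: y_def\<close>)
    then show ?thesis by (simp add: app_def y_def)
  qed
  have ip_y: "ip T y g = ip S x g" for g
  proof -
    have "ip T y g = (\<Sum>j\<in>S. y j * g j)"
      unfolding ip_def by (rule sum.mono_neutral_right) (use assms fin in \<open>auto simp: y_def\<close>)
    then show ?thesis by (simp add: ip_def y_def)
  qed
  have yy: "ip T y y = ip S x x" unfolding ip_y by (simp add: ip_def y_def)
  have yQ: "ip T y (app T Q y) = ip S x (app S Q x)" unfolding ip_y app_y[abs_def] ..
  show "a * ip S x x \<le> ip S x (app S Q x)" "ip S x (app S Q x) \<le> b * ip S x x"
    using lower[of y] upper[of y] unfolding yy yQ by auto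
next
  show "finite S" using assms fin finite_subset by blast
next
  fix i j assume "i \<in> S" "j \<in> S"
  then show "Q i j = Q j i" using sym assms by blast
next
  fix i j assume "i \<in> S" "j \<in> S" "\<bar>int i - int j\<bar> > int k"
  then show "Q i j = 0" using band assms by blast
qed (rule k ab q r)+

text \<open>Nonnegativity of the form at the sum and the difference of two unit vectors gives
  \<open>2 |Q i j| <= Q i i + Q j j\<close>, and the diagonal is at most \<open>b\<close>.\<close>

lemma entry_le:
  assumes "i \<in> T" "j \<in> T"
  shows "\<bar>Q i j\<bar> \<le> b"
proof -
  let ?e = "\<lambda>i j. of_bool (j = i) :: real"
  have diag: "Q l l \<le> b" if "l \<in> T" for l
    using upper[of "?e l"] that fin by (simp add: ip_indicator app_indicator)
  have pos: "0 \<le> ip T x (app T Q x)" for x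
    using lower[of x] ip_nonneg[of T x] ab by (smt (verit) mult_nonneg_nonneg)
  have "0 \<le> ip T (\<lambda>l. ?e i l + ?e j l) (app T Q (\<lambda>l. ?e i l + ?e j l))"
       "0 \<le> ip T (\<lambda>l. ?e i l - ?e j l) (app T Q (\<lambda>l. ?e i l - ?e j l))"
    by (rule pos)+
  moreover have "ip T (?e l) (app T Q (?e l')) = Q l l'" if "l \<in> T" "l' \<in> T" for l l'
    using that fin by (simp add: ip_indicator app_indicator)
  ultimately have "0 \<le> Q i i + Q j j + 2 * Q i j" "0 \<le> Q i i + Q j j - 2 * Q i j"
    using assms sym[of i j] unfolding app_add app_diff ip_add_left ip_diff_left ip_add_right ip_diff_right
    by (simp_all del: of_bool_eq)
  then show ?thesis using diag assms by (smt (verit))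
qed

abbreviation V :: real where "V \<equiv> column_bound a r"
abbreviation E :: real where "E \<equiv> truncation_bound a b k q r"

section \<open>The last column of an inverse and its truncation\<close>

context
  fixes v i
  assumes i: "i \<in> T" and le_i: "T \<subseteq> {..i}"
    and v: "\<And>j. j \<in> T \<Longrightarrow> app T Q v j = of_bool (j = i)"
begin

lemma inverse_column_decay:
  assumes "j \<in> T"
  shows "\<bar>v j\<bar> \<le> 2 / a * r ^ (i - j)"
proof -
  have "\<bar>v j\<bar> \<le> 2 / a * r ^ (i - j) * 1"
  proof (rule decay[OF v])
    show "ip T (\<lambda>j. of_bool (j = i)) (\<lambda>j. of_bool (j = i)) \<le> (1::real)\<^sup>2"
      using fin i by (simp add: ip_indicator)
  qed (use assms in auto)
  then show ?thesis by simp
qed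

text \<open>Every entry at distance at least \<open>m\<close> from \<open>i\<close> has a factor
  \<open>r ^ m\<close>; what remains sums to a geometric series. With \<open>m = 0\<close> it bounds
  the whole column.\<close>

lemma inverse_column_sum_old:
  assumes "S \<subseteq> T" "\<And>j. j \<in> S \<Longrightarrow> j + m \<le> i"
  shows "(\<Sum>j\<in>S. \<bar>v j\<bar>) \<le> V * r ^ m"
proof -
  have "(\<Sum>j\<in>S. \<bar>v j\<bar>) \<le> (\<Sum>j\<in>S. 2 / a * r ^ m * r ^ (i - m - j))"
  proof (rule sum_mono)
    fix j assume "j \<in> S"
    then have "i - j = m + (i - m - j)" using assms(2)[of j] by simp
    then have "r ^ (i - j) = r ^ m * r ^ (i - m - j)" by (metis power_add)
    then show "\<bar>v j\<bar> \<le> 2 / a * r ^ m * r ^ (i - m - j)"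
      using inverse_column_decay[of j] \<open>j \<in> S\<close> assms(1) by (auto simp: mult.assoc)
  qed
  also have "\<dots> = 2 / a * r ^ m * (\<Sum>j\<in>S. r ^ (i - m - j))" by (simp add: sum_distrib_left)
  also have "\<dots> \<le> 2 / a * r ^ m * (1 / (1 - r))"
  proof (rule mult_left_mono, rule sum_power_inj_le)
    show "finite S" using assms(1) fin finite_subset by blast
    show "inj_on (\<lambda>j. i - m - j) S"
    proof (rule inj_onI)
      fix x y assume "x \<in> S" "y \<in> S" "i - m - x = i - m - y"
      then show "x = y" using assms(2)[of x] assms(2)[of y] by simp
    qed
  qed (use ab r r1 in auto)
  finally show ?thesis by (simp add: column_bound_def mult_ac)
qed

lemma inverse_column_sum: "(\<Sum>j\<in>T. \<bar>v j\<bar>) \<le> V"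
  using inverse_column_sum_old[of T 0] le_i by auto

text \<open>The form is nonnegative at \<open>v - e_i / b\<close>, which reads
  \<open>0 <= v i - 2 / b + Q i i / b^2\<close>, and \<open>Q i i <= b\<close>. This keeps the
  denominator of the arc term away from zero.\<close>

lemma inverse_diag_ge: "1 / b \<le> v i"
proof -
  let ?e = "\<lambda>j. of_bool (j = i) :: real"
  let ?x = "\<lambda>j. v j - (1 / b) * ?e j"
  have "ip T v (app T Q v) = ip T v ?e" unfolding ip_def by (intro sum.cong refl) (simp add: v)
  then have 1: "ip T v (app T Q v) = v i" using fin i by (metis ip_commute ip_indicator)
  have 2: "ip T ?e (app T Q v) = 1" using fin i v by (simp add: ip_indicator)
  have 3: "ip T v (app T Q ?e) = 1" using 2 ip_app_commute[of T Q v ?e] sym by (simp add: ip_commute)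
  have 4: "ip T ?e (app T Q ?e) \<le> b" using entry_le[OF i i] fin i by (simp add: ip_indicator app_indicator)
  have "0 \<le> ip T ?x (app T Q ?x)"
    using lower[of ?x] ip_nonneg[of T ?x] ab by (smt (verit) mult_nonneg_nonneg)
  also have "ip T ?x (app T Q ?x) = v i - 2 / b + (1 / b) * (1 / b) * ip T ?e (app T Q ?e)"
    unfolding app_diff app_scale ip_diff_left ip_diff_right ip_scale_left ip_scale_right 1 2 3
    by (simp add: algebra_simps)
  also have "\<dots> \<le> v i - 2 / b + (1 / b) * (1 / b) * b"
    using 4 ab by (intro add_left_mono mult_left_mono) auto
  finally show ?thesis using ab by simp
qed

text \<open>On the window, \<open>v - w\<close> solves a system whose right-hand side is the
  coupling to the old entries of \<open>v\<close>. It is small because these entries are, and it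
  sits near the cut, so the solution decays away from the cut and is summable independently of the
  window size.\<close>

lemma truncation_effect:
  fixes m :: nat
  defines "T' \<equiv> {j \<in> T. i \<le> j + m}"
  assumes w: "\<And>j. j \<in> T' \<Longrightarrow> app T' Q w j = of_bool (j = i)"
  shows "(\<Sum>j\<in>T - T'. \<bar>v j\<bar>) + (\<Sum>j\<in>T'. \<bar>v j - w j\<bar>) \<le> E * r ^ m"
proof -
  have T': "T' \<subseteq> T" by (auto simp: T'_def)
  then have fT': "finite T'" using fin finite_subset by blast
  define old where "old = (\<Sum>l\<in>T - T'. \<bar>v l\<bar>)"
  have old: "old \<le> V * r ^ m"
    unfolding old_def by (rule inverse_column_sum_old) (auto simp: T'_def)
  have old0: "0 \<le> old" by (simp add: old_def sum_nonneg)
  \<comment> \<open>Moving the old columns to the right-hand side of the system for \<open>v\<close>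
    leaves this source on the window.\<close>
  define f where "f = (\<lambda>j. - (\<Sum>l\<in>T - T'. Q j l * v l))"
  define M where "M = k * b * old"
  have M: "0 \<le> M" "M \<le> k * b * (V * r ^ m)" using old old0 ab by (auto simp: M_def intro!: mult_left_mono)
  interpret T': banded_form T' Q a b k q r by (rule subset_banded_form[OF T'])
  have f: "app T' Q (\<lambda>j. v j - w j) j = f j" if "j \<in> T'" for j
  proof -
    have "app T Q v j = (\<Sum>l\<in>T - T'. Q j l * v l) + app T' Q v j"
      unfolding app_def using T' fin by (simp add: sum.subset_diff)
    then show ?thesis using v[of j] w[OF that] that T' by (auto simp: app_diff f_def)
  qed
  \<comment> \<open>An old index lies below the window, so by the bandwidth it meets at most the
    \<open>k\<close> indices following it.\<close>
  have row: "(\<Sum>j\<in>T'. \<bar>Q j l\<bar>) \<le> k * b" if l: "l \<in> T - T'" for l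
  proof -
    have "(\<Sum>j\<in>T'. \<bar>Q j l\<bar>) = (\<Sum>j\<in>T' \<inter> {l<..l + k}. \<bar>Q j l\<bar>)"
    proof (rule sum.mono_neutral_right)
      show "\<forall>j\<in>T' - T' \<inter> {l<..l + k}. \<bar>Q j l\<bar> = 0"
      proof
        fix j assume j: "j \<in> T' - T' \<inter> {l<..l + k}"
        then have "\<bar>int j - int l\<bar> > int k" using l by (auto simp: T'_def)
        then show "\<bar>Q j l\<bar> = 0" using band j l T' by auto
      qed
    qed (use fT' in auto)
    also have "\<dots> \<le> of_nat (card (T' \<inter> {l<..l + k})) * b"
      using entry_le l T' by (intro sum_bounded_above) auto
    also have "\<dots> \<le> k * b"
    proof -
      have "card (T' \<inter> {l<..l + k}) \<le> card {l<..l + k}" by (rule card_mono) auto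
      then show ?thesis using ab by (intro mult_right_mono) auto
    qed
    finally show ?thesis .
  qed
  have "(\<Sum>j\<in>T'. \<bar>f j\<bar>) \<le> (\<Sum>j\<in>T'. \<Sum>l\<in>T - T'. \<bar>Q j l\<bar> * \<bar>v l\<bar>)"
    unfolding f_def abs_minus_cancel abs_mult[symmetric] by (intro sum_mono sum_abs)
  also have "\<dots> = (\<Sum>l\<in>T - T'. (\<Sum>j\<in>T'. \<bar>Q j l\<bar>) * \<bar>v l\<bar>)"
    unfolding sum_distrib_right by (rule sum.swap)
  also have "\<dots> \<le> (\<Sum>l\<in>T - T'. (k * b) * \<bar>v l\<bar>)"
    using row by (intro sum_mono mult_right_mono) auto
  also have "\<dots> = M" by (simp add: M_def old_def sum_distrib_left)
  finally have "(\<Sum>j\<in>T'. \<bar>f j\<bar>)\<^sup>2 \<le> M\<^sup>2" by (intro power_mono) (auto simp: sum_nonneg)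
  then have nf: "ip T' f f \<le> M\<^sup>2" using sum_squares_le_square_sum[OF fT', of f] by linarith
  have delta: "\<bar>v j - w j\<bar> \<le> 2 / a * M / q * r ^ (j - (i - m))" if j: "j \<in> T'" for j
  proof -
    \<comment> \<open>The source occupies at most the first \<open>k\<close> positions of the
      window. For \<open>j\<close> among them the subtraction yields 0; in general the lost
      \<open>k\<close> steps cost the factor \<open>1 / q\<close>.\<close>
    define D where "D = j - (i - m) - k"
    have "\<bar>v j - w j\<bar> \<le> 2 / a * r ^ D * M"
    proof (rule T'.decay[OF f nf M(1) j])
      fix l assume l: "l \<in> T'" "f l \<noteq> 0"
      then obtain l' where l': "l' \<in> T - T'" "Q l l' \<noteq> 0"
        unfolding f_def by (metis (no_types, lifting) mult_eq_0_iff neg_equal_0_iff_equal sum.neutral)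
      then have "\<not> \<bar>int l - int l'\<bar> > int k" using band[of l l'] l T' by auto
      moreover have "l' + m < i" using l' by (auto simp: T'_def)
      ultimately show "int D \<le> \<bar>int j - int l\<bar>" unfolding D_def by linarith
    qed
    also have "\<dots> \<le> 2 / a * (r ^ (j - (i - m)) / q) * M"
    proof -
      have "r ^ (D + k) \<le> r ^ (j - (i - m))"
        by (rule power_decreasing) (use r r1 in \<open>auto simp: D_def\<close>)
      then have "r ^ D \<le> r ^ (j - (i - m)) / q" using q r(2) by (simp add: power_add pos_le_divide_eq)
      then show ?thesis using ab M by (intro mult_right_mono mult_left_mono) auto
    qed
    finally show ?thesis by (simp add: mult_ac)
  qed
  have "(\<Sum>j\<in>T'. \<bar>v j - w j\<bar>) \<le> (\<Sum>j\<in>T'. 2 / a * M / q * r ^ (j - (i - m)))"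
    by (intro sum_mono delta)
  also have "\<dots> = 2 / a * M / q * (\<Sum>j\<in>T'. r ^ (j - (i - m)))" by (simp add: sum_distrib_left)
  also have "\<dots> \<le> 2 / a * M / q * (1 / (1 - r))"
  proof (rule mult_left_mono, rule sum_power_inj_le[OF fT'])
    show "inj_on (\<lambda>j. j - (i - m)) T'" by (rule inj_onI) (auto simp: T'_def)
  qed (use ab r r1 q M in auto)
  also have "\<dots> = M * (2 / (a * q * (1 - r)))" by simp
  also have "\<dots> \<le> k * b * (V * r ^ m) * (2 / (a * q * (1 - r)))"
    using M(2) by (rule mult_right_mono) (use ab q r1 in auto)
  finally have "(\<Sum>j\<in>T'. \<bar>v j - w j\<bar>) \<le> k * b * (V * r ^ m) * (2 / (a * q * (1 - r)))" .
  then show ?thesis using old unfolding old_def truncation_bound_def by (simp add: algebra_simps)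
qed

text \<open>The l1 bounds on the columns and on their change become bounds on numerator and
  denominator of the arc term. The factor in front is independent of the size of \<open>T\<close>;
  it later becomes the constant \<open>C\<close>.\<close>

lemma truncated_quotient_diff:
  fixes m :: nat
  defines "T' \<equiv> {j \<in> T. i \<le> j + m}"
  assumes w: "\<And>j. j \<in> T' \<Longrightarrow> app T' Q w j = of_bool (j = i)"
    and d: "\<And>j. j \<in> T \<Longrightarrow> \<bar>d j\<bar> \<le> D"
  shows "\<bar>(ip T d v)\<^sup>2 / v i - (ip T' d w)\<^sup>2 / w i\<bar> \<le> (2 * b * V * E + b\<^sup>2 * V\<^sup>2 * E) * (D\<^sup>2 * r ^ m)"
proof -
  have T': "T' \<subseteq> T" by (auto simp: T'_def)
  then have fT': "finite T'" using fin finite_subset by blast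
  have iT': "i \<in> T'" using i by (simp add: T'_def)
  have D: "0 \<le> D" using d[OF i] by linarith
  interpret T': banded_form T' Q a b k q r by (rule subset_banded_form[OF T'])
  have T'i: "T' \<subseteq> {..i}" using T' le_i by auto
  note eff = truncation_effect[OF w[unfolded T'_def], folded T'_def]
  have bound: "\<bar>ip S d x\<bar> \<le> D * (\<Sum>j\<in>S. \<bar>x j\<bar>)" if "S \<subseteq> T" for S x
  proof -
    have "\<bar>ip S d x\<bar> \<le> (\<Sum>j\<in>S. \<bar>d j * x j\<bar>)" unfolding ip_def by (rule sum_abs)
    also have "\<dots> \<le> (\<Sum>j\<in>S. D * \<bar>x j\<bar>)"
      unfolding abs_mult using d that by (intro sum_mono mult_right_mono) auto
    finally show ?thesis by (simp add: sum_distrib_left)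
  qed
  have "\<bar>(ip T d v)\<^sup>2 / v i - (ip T' d w)\<^sup>2 / w i\<bar>
      \<le> b * (2 * (D * V) * (D * (E * r ^ m))) + b\<^sup>2 * ((D * V)\<^sup>2 * (E * r ^ m))"
  proof (rule abs_quotient_diff_le)
    show "\<bar>ip T d v\<bar> \<le> D * V"
      using bound[of T v] inverse_column_sum D by (smt (verit) mult_left_mono order_refl)
    show "\<bar>ip T' d w\<bar> \<le> D * V"
      using bound[OF T', of w] T'.inverse_column_sum[OF iT' T'i w] D by (smt (verit) mult_left_mono)
    have "ip T d v = ip (T - T') d v + ip T' d v"
      unfolding ip_def using T' fin by (simp add: sum.subset_diff)
    then have "ip T d v - ip T' d w = ip (T - T') d v + ip T' d (\<lambda>j. v j - w j)"
      by (simp add: ip_diff_right)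
    then have "\<bar>ip T d v - ip T' d w\<bar> \<le> D * ((\<Sum>j\<in>T - T'. \<bar>v j\<bar>) + (\<Sum>j\<in>T'. \<bar>v j - w j\<bar>))"
      using bound[of "T - T'" v] bound[OF T', of "\<lambda>j. v j - w j"] unfolding distrib_left by force
    then show "\<bar>ip T d v - ip T' d w\<bar> \<le> D * (E * r ^ m)"
      using eff D by (smt (verit) mult_left_mono)
    show "1 / b \<le> v i" by (rule inverse_diag_ge)
    show "1 / b \<le> w i" by (rule T'.inverse_diag_ge[OF iT' T'i w])
    have "\<bar>v i - w i\<bar> \<le> (\<Sum>j\<in>T'. \<bar>v j - w j\<bar>)"
      using fT' iT' by (intro member_le_sum[of i T' "\<lambda>j. \<bar>v j - w j\<bar>"]) auto
    moreover have "0 \<le> (\<Sum>j\<in>T - T'. \<bar>v j\<bar>)" by (simp add: sum_nonneg)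
    ultimately show "\<bar>v i - w i\<bar> \<le> E * r ^ m" using eff by linarith
  qed (use ab in auto)
  also have "\<dots> = (2 * b * V * E + b\<^sup>2 * V\<^sup>2 * E) * (D\<^sup>2 * r ^ m)"
    by (simp add: power2_eq_square algebra_simps)
  finally show ?thesis .
qed

end

end

subsection \<open>Rayleigh bounds from the extreme eigenvalues\<close>

lemma app_bounded:
  assumes "finite T"
  shows "\<exists>c>0. \<forall>x. ip T (app T A x) (app T A x) \<le> c * ip T x x"
proof -
  define K where "K = (\<Sum>i\<in>T. \<Sum>j\<in>T. \<bar>A i j\<bar>)"
  have K: "0 \<le> K" by (simp add: K_def sum_nonneg)
  \<comment> \<open>The added 1 keeps the constant positive when \<open>K\<close> is 0.\<close>
  have "ip T (app T A x) (app T A x) \<le> (K\<^sup>2 + 1) * ip T x x" for x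
  proof -
    define s where "s = sqrt (ip T x x)"
    have s: "0 \<le> s" "s\<^sup>2 = ip T x x" by (simp_all add: s_def ip_nonneg)
    have xj: "\<bar>x j\<bar> \<le> s" if "j \<in> T" for j
    proof -
      have "(x j)\<^sup>2 \<le> ip T x x"
        unfolding ip_def power2_eq_square using that assms by (intro member_le_sum) auto
      then show ?thesis unfolding s_def by (metis real_sqrt_abs real_sqrt_le_iff)
    qed
    have "(\<Sum>i\<in>T. \<bar>app T A x i\<bar>) \<le> (\<Sum>i\<in>T. \<Sum>j\<in>T. \<bar>A i j\<bar> * s)"
      unfolding app_def
      by (intro sum_mono order_trans[OF sum_abs]) (auto simp: abs_mult intro!: mult_left_mono xj)
    also have "\<dots> = K * s" by (simp add: K_def sum_distrib_right)
    finally have "(\<Sum>i\<in>T. \<bar>app T A x i\<bar>)\<^sup>2 \<le> (K * s)\<^sup>2" by (intro power_mono) (auto simp: sum_nonneg)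
    then have "ip T (app T A x) (app T A x) \<le> K\<^sup>2 * ip T x x"
      using sum_squares_le_square_sum[OF assms, of "app T A x"] s by (simp add: power_mult_distrib)
    then show ?thesis using ip_nonneg[of T x] by (simp add: distrib_right)
  qed
  moreover have "0 < K\<^sup>2 + 1" by (simp add: add_nonneg_pos)
  ultimately show ?thesis by blast
qed

lemma form_bounded:
  assumes "finite T"
  shows "\<exists>c>0. \<forall>x. \<bar>ip T x (app T A x)\<bar> \<le> c * ip T x x"
proof -
  obtain c where c: "c > 0" "\<And>x. ip T (app T A x) (app T A x) \<le> c * ip T x x"
    using app_bounded[OF assms] by blast
  have "\<bar>ip T x (app T A x)\<bar> \<le> ((1 + c) / 2) * ip T x x" for x
  proof -
    define y where "y = app T A x"
    have "0 \<le> ip T (\<lambda>i. x i + y i) (\<lambda>i. x i + y i)" "0 \<le> ip T (\<lambda>i. x i - y i) (\<lambda>i. x i - y i)"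
      by (rule ip_nonneg)+
    then have "2 * \<bar>ip T x y\<bar> \<le> ip T x x + ip T y y"
      by (simp add: ip_linear ip_commute[of T y x])
    then show ?thesis using c(2)[of x] unfolding y_def[symmetric] by (simp add: field_simps)
  qed
  then show ?thesis using c(1) by (intro exI[of _ "(1 + c) / 2"]) auto
qed

text \<open>For \<open>y = A x\<close> and a bound \<open>c\<close> of the form, nonnegativity at
  \<open>c x - y\<close> gives \<open>0 <= c^2 <x, y> - 2 c |y|^2 + <y, A y>\<close>, where the last
  term is at most \<open>c |y|^2\<close>.\<close>

lemma psd_image_bounded:
  assumes "finite T" and sym: "\<And>i j. i \<in> T \<Longrightarrow> j \<in> T \<Longrightarrow> A i j = A j i"
    and psd: "\<And>x. 0 \<le> ip T x (app T A x)"
  shows "\<exists>c>0. \<forall>x. ip T (app T A x) (app T A x) \<le> c * ip T x (app T A x)"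
proof -
  obtain c where c: "c > 0" "\<And>x. \<bar>ip T x (app T A x)\<bar> \<le> c * ip T x x"
    using form_bounded[OF assms(1)] by blast
  have "ip T (app T A x) (app T A x) \<le> c * ip T x (app T A x)" for x
  proof -
    define y where "y = app T A x"
    have s: "ip T x (app T A y) = ip T y y" using ip_app_commute[of T A x y] sym by (simp add: y_def)
    have yy: "ip T y (app T A y) \<le> c * ip T y y" using c(2)[of y] by linarith
    have "0 \<le> ip T (\<lambda>i. c * x i - y i) (app T A (\<lambda>i. c * x i - y i))" by (rule psd)
    also have "\<dots> = c * (c * ip T x y) - 2 * c * ip T y y + ip T y (app T A y)"
      by (simp add: ip_linear s y_def[symmetric] algebra_simps)
    also have "\<dots> \<le> c * (c * ip T x y - ip T y y)" using yy by (simp add: algebra_simps)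
    finally show ?thesis using c(1) unfolding y_def by (simp add: zero_le_mult_iff)
  qed
  then show ?thesis using c(1) by blast
qed

text \<open>\<open>|x|^2 = |N A x|^2\<close> is at most a multiple of \<open>|A x|^2\<close>, hence
  of \<open><x, A x>\<close> by the previous bound.\<close>

lemma psd_left_invertible_coercive:
  assumes "finite T" and "\<And>i j. i \<in> T \<Longrightarrow> j \<in> T \<Longrightarrow> A i j = A j i"
    and "\<And>x. 0 \<le> ip T x (app T A x)"
    and inv: "\<And>x i. i \<in> T \<Longrightarrow> app T N (app T A x) i = x i"
  shows "\<exists>\<delta>>0. \<forall>x. \<delta> * ip T x x \<le> ip T x (app T A x)"
proof -
  obtain c where c: "c > 0" "\<And>x. ip T (app T A x) (app T A x) \<le> c * ip T x (app T A x)"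
    using psd_image_bounded[OF assms(1-3)] by blast
  obtain c' where c': "c' > 0" "\<And>x. ip T (app T N x) (app T N x) \<le> c' * ip T x x"
    using app_bounded[OF assms(1)] by blast
  have "1 / (c' * c) * ip T x x \<le> ip T x (app T A x)" for x
  proof -
    have "ip T x x = ip T (app T N (app T A x)) (app T N (app T A x))"
      unfolding ip_def by (intro sum.cong refl) (simp add: inv)
    also have "\<dots> \<le> c' * ip T (app T A x) (app T A x)" by (rule c'(2))
    also have "\<dots> \<le> c' * (c * ip T x (app T A x))" using c(2) c'(1) by (intro mult_left_mono) auto
    finally show ?thesis using c(1) c'(1) by (simp add: field_simps)
  qed
  then show ?thesis using c(1) c'(1) by (intro exI[of _ "1 / (c' * c)"]) auto
qed

text \<open>\<open>\<mu>\<close> is the best constant in the lower bound, a supremum. If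
  \<open>A - \<mu>\<close> had a left inverse, it would be coercive with some
  \<open>\<delta> > 0\<close>, and \<open>\<mu> + \<delta>\<close> would be a better
  constant.\<close>

lemma sharp_form_lower_bound:
  assumes T: "finite T" "T \<noteq> {}" and sym: "\<And>i j. i \<in> T \<Longrightarrow> j \<in> T \<Longrightarrow> A i j = A j i"
  obtains \<mu> where "\<And>x. \<mu> * ip T x x \<le> ip T x (app T A x)"
    and "\<not> (\<exists>N. \<forall>x. \<forall>i\<in>T. app T N (\<lambda>i. app T A x i - \<mu> * x i) i = x i)"
proof -
  define S where "S = {t. \<forall>x. t * ip T x x \<le> ip T x (app T A x)}"
  obtain c where c: "c > 0" "\<And>x. \<bar>ip T x (app T A x)\<bar> \<le> c * ip T x x"
    using form_bounded[OF T(1)] by blast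
  have mc: "- c \<in> S" unfolding S_def using c(2) by (auto simp: abs_le_iff) (metis add.inverse_inverse neg_le_iff_le)
  obtain i where i: "i \<in> T" using T(2) by blast
  have ub: "t \<le> A i i" if "t \<in> S" for t
  proof -
    have "t * ip T (\<lambda>j. of_bool (j = i)) (\<lambda>j. of_bool (j = i))
        \<le> ip T (\<lambda>j. of_bool (j = i)) (app T A (\<lambda>j. of_bool (j = i)))"
      using that by (simp only: S_def mem_Collect_eq)
    then show ?thesis using T(1) i by (simp add: ip_indicator app_indicator)
  qed
  have bdd: "bdd_above S" using ub by (intro bdd_aboveI)
  define \<mu> where "\<mu> = Sup S"
  have low: "\<mu> * ip T x x \<le> ip T x (app T A x)" for x
  \<comment> \<open>Passing to the supremum divides by \<open>ip T x x\<close>; if that is 0, the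
    bound for \<open>- c\<close> already says that the form is nonnegative.\<close>
  proof (cases "ip T x x = 0")
    case True
    moreover have "- c * ip T x x \<le> ip T x (app T A x)" using mc unfolding S_def by blast
    ultimately show ?thesis by simp
  next
    case False
    then have pos: "0 < ip T x x" using ip_nonneg[of T x] by linarith
    have "\<mu> \<le> ip T x (app T A x) / ip T x x"
      unfolding \<mu>_def
    proof (rule cSup_least)
      fix t assume "t \<in> S"
      then show "t \<le> ip T x (app T A x) / ip T x x" using pos by (simp add: S_def pos_le_divide_eq)
    qed (use mc in blast)
    then show ?thesis using pos by (simp add: pos_le_divide_eq)
  qed
  have "\<not> (\<exists>N. \<forall>x. \<forall>i\<in>T. app T N (\<lambda>i. app T A x i - \<mu> * x i) i = x i)"
  proof
    assume "\<exists>N. \<forall>x. \<forall>i\<in>T. app T N (\<lambda>i. app T A x i - \<mu> * x i) i = x i"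
    then obtain N where N: "\<And>x i. i \<in> T \<Longrightarrow> app T N (\<lambda>i. app T A x i - \<mu> * x i) i = x i" by blast
    define M where "M = (\<lambda>i j. A i j - (if i = j then \<mu> else 0))"
    have appM: "app T M x i = app T A x i - \<mu> * x i" if "i \<in> T" for x i
    proof -
      have "app T M x i = (\<Sum>j\<in>T. A i j * x j - (if i = j then \<mu> * x j else 0))"
        unfolding app_def M_def by (intro sum.cong refl) (auto simp: algebra_simps)
      then show ?thesis using that T(1) by (simp add: sum_subtractf app_def)
    qed
    have ipM: "ip T x (app T M x) = ip T x (app T A x) - \<mu> * ip T x x" for x
    proof -
      have "ip T x (app T M x) = ip T x (\<lambda>i. app T A x i - \<mu> * x i)"
        unfolding ip_def by (intro sum.cong refl) (simp add: appM)
      then show ?thesis by (simp only: ip_diff_right ip_scale_right)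
    qed
    have "\<exists>\<delta>>0. \<forall>x. \<delta> * ip T x x \<le> ip T x (app T M x)"
    proof (rule psd_left_invertible_coercive[OF T(1)])
      show "M i j = M j i" if "i \<in> T" "j \<in> T" for i j using sym that by (simp add: M_def)
      show "0 \<le> ip T x (app T M x)" for x using low[of x] by (simp add: ipM)
      show "app T N (app T M x) i = x i" if "i \<in> T" for x i
      proof -
        have "app T N (app T M x) i = app T N (\<lambda>i. app T A x i - \<mu> * x i) i"
          unfolding app_def[of T N] by (intro sum.cong refl) (simp add: appM)
        then show ?thesis using N that by simp
      qed
    qed
    then obtain \<delta> where \<delta>: "\<delta> > 0" "\<And>x. \<delta> * ip T x x \<le> ip T x (app T A x) - \<mu> * ip T x x"
      unfolding ipM by blast
    then have "\<mu> + \<delta> \<in> S" by (simp add: S_def algebra_simps)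
    then show False using cSup_upper[OF _ bdd, of "\<mu> + \<delta>"] \<delta>(1) by (simp add: \<mu>_def)
  qed
  with low that show ?thesis by blast
qed

abbreviation entries :: "real mat \<Rightarrow> nat \<Rightarrow> nat \<Rightarrow> real" where
  "entries Q \<equiv> \<lambda>i j. Q $$ (i, j)"

lemma scalar_prod_eq_ip:
  "y \<in> carrier_vec n \<Longrightarrow> x \<bullet> y = ip {..<n} (($) x) (($) y)"
  by (simp add: scalar_prod_def ip_def atLeast0LessThan)

lemma mult_mat_vec_eq_app:
  assumes "A \<in> carrier_mat n n" "x \<in> carrier_vec n" "i < n"
  shows "(A *\<^sub>v x) $ i = app {..<n} (entries A) (($) x) i"
  using assms by (simp add: scalar_prod_def app_def atLeast0LessThan)

text \<open>If the sharp constant were no eigenvalue, the characteristic matrix would have nonzero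
  determinant, and its inverse would be the excluded left inverse.\<close>

lemma sym_min_eigenvalue:
  assumes A: "A \<in> carrier_mat n n" and sym: "transpose_mat A = (A :: real mat)" and n: "n \<ge> 1"
  obtains \<mu> where "eigenvalue A \<mu>"
    and "\<And>x. \<mu> * ip {..<n} x x \<le> ip {..<n} x (app {..<n} (entries A) x)"
proof -
  have s: "A $$ (i, j) = A $$ (j, i)" if "i < n" "j < n" for i j
    using that A sym by (metis carrier_matD index_transpose_mat(1))
  obtain \<mu> where low: "\<And>x. \<mu> * ip {..<n} x x \<le> ip {..<n} x (app {..<n} (entries A) x)"
    and ninv: "\<not> (\<exists>N. \<forall>x. \<forall>i\<in>{..<n}. app {..<n} N (\<lambda>i. app {..<n} (entries A) x i - \<mu> * x i) i = x i)"
    using sharp_form_lower_bound[of "{..<n}" "entries A"] s n by (auto simp: lessThan_empty_iff)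
  have "eigenvalue A \<mu>"
  proof (rule ccontr)
    define M where "M = char_matrix A \<mu>"
    have M: "M \<in> carrier_mat n n" using A by (simp add: M_def char_matrix_def)
    assume "\<not> eigenvalue A \<mu>"
    then have "det M \<noteq> 0" using eigenvalue_det[OF A] by (simp add: M_def)
    from det_non_zero_imp_unit[OF M this, of "()"]
    obtain N where N: "N \<in> carrier_mat n n" "N * M = 1\<^sub>m n"
      unfolding Units_def ring_mat_def by auto
    have "app {..<n} (entries N) (\<lambda>i. app {..<n} (entries A) x i - \<mu> * x i) i = x i" if i: "i < n" for x i
    proof -
      define y where "y = vec n x"
      have y: "y \<in> carrier_vec n" by (simp add: y_def)
      have My: "(M *\<^sub>v y) $ j = app {..<n} (entries A) x j - \<mu> * x j" if "j < n" for j
      proof -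
        have "(M *\<^sub>v y) $ j = (\<Sum>l<n. A $$ (j, l) * x l - (if j = l then \<mu> * x l else 0))"
          using that A unfolding mult_mat_vec_eq_app[OF M y that] app_def
          by (intro sum.cong refl) (auto simp: M_def char_matrix_def y_def algebra_simps)
        then show ?thesis using that by (simp add: sum_subtractf app_def)
      qed
      have "x i = (N *\<^sub>v (M *\<^sub>v y)) $ i"
        using assoc_mult_mat_vec[OF N(1) M y] N(2) y i by (simp add: y_def)
      also have "\<dots> = app {..<n} (entries N) (($) (M *\<^sub>v y)) i"
        using mult_mat_vec_eq_app[OF N(1) _ i] M y by simp
      also have "\<dots> = app {..<n} (entries N) (\<lambda>i. app {..<n} (entries A) x i - \<mu> * x i) i"
        unfolding app_def[of _ "entries N"] by (intro sum.cong refl) (simp add: My)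
      finally show ?thesis by simp
    qed
    then show False using ninv by blast
  qed
  with low that show ?thesis by blast
qed

text \<open>The eigenvalue bounding the form from below is at least the minimum of the spectrum. The
  upper bound is the same argument for \<open>- Q\<close>, and positivity comes from testing with an
  eigenvector.\<close>

lemma spectrum_form_bounds:
  assumes Q: "sym_pos_def n Q" and n: "n \<ge> 1"
  shows "0 < Min (spectrum Q)" "Min (spectrum Q) \<le> Max (spectrum Q)"
    "Min (spectrum Q) * ip {..<n} x x \<le> ip {..<n} x (app {..<n} (entries Q) x)"
    "ip {..<n} x (app {..<n} (entries Q) x) \<le> Max (spectrum Q) * ip {..<n} x x"
proof -
  have c: "Q \<in> carrier_mat n n" and sym: "transpose_mat Q = Q"
    and pos: "\<And>x. x \<in> carrier_vec n \<Longrightarrow> x \<noteq> 0\<^sub>v n \<Longrightarrow> 0 < x \<bullet> (Q *\<^sub>v x)"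
    using Q by (auto simp: sym_pos_def_def)
  have fin: "finite (spectrum Q)" by (rule card_finite_spectrum(1)[OF c])
  obtain \<mu> where \<mu>: "eigenvalue Q \<mu>"
    "\<And>x. \<mu> * ip {..<n} x x \<le> ip {..<n} x (app {..<n} (entries Q) x)"
    using sym_min_eigenvalue[OF c sym n] by blast
  obtain \<nu> where \<nu>: "eigenvalue (- Q) \<nu>"
    "\<And>x. \<nu> * ip {..<n} x x \<le> ip {..<n} x (app {..<n} (entries (- Q)) x)"
    using sym_min_eigenvalue[of "- Q" n] c sym n by (auto simp: transpose_uminus)
  have \<mu>S: "\<mu> \<in> spectrum Q" using \<mu>(1) by (simp add: spectrum_def)
  have \<nu>S: "- \<nu> \<in> spectrum Q"
  proof -
    obtain v where v: "v \<in> carrier_vec n" "v \<noteq> 0\<^sub>v n" "- Q *\<^sub>v v = \<nu> \<cdot>\<^sub>v v"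
      using \<nu>(1) c by (auto simp: eigenvalue_def eigenvector_def)
    have "Q *\<^sub>v v = - \<nu> \<cdot>\<^sub>v v"
    proof (rule eq_vecI)
      fix i assume i: "i < dim_vec (- \<nu> \<cdot>\<^sub>v v)"
      have "(- Q *\<^sub>v v) $ i = - ((Q *\<^sub>v v) $ i)" using i c v(1) by (simp add: scalar_prod_def sum_negf)
      then show "(Q *\<^sub>v v) $ i = (- \<nu> \<cdot>\<^sub>v v) $ i" using i v by simp
    qed (use c v in auto)
    then show ?thesis using v c by (auto simp: spectrum_def eigenvalue_def eigenvector_def)
  qed
  have ne: "spectrum Q \<noteq> {}" using \<mu>S by blast
  show le: "Min (spectrum Q) \<le> Max (spectrum Q)" using fin ne by (meson Max_ge Min_in)
  have "Min (spectrum Q) \<in> spectrum Q" using fin ne by (rule Min_in)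
  then obtain v where v: "v \<in> carrier_vec n" "v \<noteq> 0\<^sub>v n" "Q *\<^sub>v v = Min (spectrum Q) \<cdot>\<^sub>v v"
    using c by (auto simp: spectrum_def eigenvalue_def eigenvector_def)
  have "0 < Min (spectrum Q) * (v \<bullet> v)" using pos[OF v(1,2)] v by simp
  moreover have "0 \<le> v \<bullet> v" using v(1) by (simp add: scalar_prod_eq_ip[of _ n] ip_nonneg)
  ultimately show "0 < Min (spectrum Q)" by (simp add: zero_less_mult_iff)
  have "Min (spectrum Q) * ip {..<n} x x \<le> \<mu> * ip {..<n} x x"
    using fin \<mu>S by (intro mult_right_mono ip_nonneg) auto
  also have "\<dots> \<le> ip {..<n} x (app {..<n} (entries Q) x)" by (rule \<mu>(2))
  finally show "Min (spectrum Q) * ip {..<n} x x \<le> ip {..<n} x (app {..<n} (entries Q) x)" .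
  have "app {..<n} (entries (- Q)) x i = - app {..<n} (entries Q) x i" if "i < n" for i
    using that c by (simp add: app_def sum_negf)
  then have "ip {..<n} x (app {..<n} (entries (- Q)) x) = - ip {..<n} x (app {..<n} (entries Q) x)"
    by (simp add: ip_def sum_negf)
  then have "ip {..<n} x (app {..<n} (entries Q) x) \<le> - \<nu> * ip {..<n} x x" using \<nu>(2)[of x] by simp
  also have "\<dots> \<le> Max (spectrum Q) * ip {..<n} x x"
    using fin \<nu>S by (intro mult_right_mono ip_nonneg) auto
  finally show "ip {..<n} x (app {..<n} (entries Q) x) \<le> Max (spectrum Q) * ip {..<n} x x" .
qed

subsection \<open>Stored matrices as padded inverses\<close>

text \<open>The state reached by \<open>p\<close> when nothing is merged. The nodes of the truncated
  diagram turn out to be such states for truncated words.\<close>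

definition node :: "real mat \<Rightarrow> bool list \<Rightarrow> dd_node" where
  "node Q p = foldl (dd_state Q) ([], 0\<^sub>m (dim_row Q) (dim_row Q)) p"

lemma node_Nil: "node Q [] = ([], 0\<^sub>m (dim_row Q) (dim_row Q))"
  by (simp add: node_def)

lemma node_snoc: "node Q (p @ [b]) = dd_state Q (node Q p) b"
  by (simp add: node_def)

lemma fst_node [simp]: "fst (node Q p) = p"
  by (induction p rule: rev_induct) (simp_all add: node_Nil node_snoc dd_state_def)

definition ones :: "bool list \<Rightarrow> nat set" where
  "ones p = {j. j < length p \<and> p ! j}"

lemma ones_snoc: "ones (p @ [b]) = (if b then insert (length p) (ones p) else ones p)"
  by (auto simp: ones_def nth_append less_Suc_eq)

lemma ones_subset: "ones p \<subseteq> {..<length p}"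
  by (auto simp: ones_def)

locale spd =
  fixes n :: nat and Q :: "real mat"
  assumes spd: "sym_pos_def n Q"
begin

lemma carrier_Q [simp]: "Q \<in> carrier_mat n n"
  and transpose_Q: "transpose_mat Q = Q"
  and form_pos: "x \<in> carrier_vec n \<Longrightarrow> x \<noteq> 0\<^sub>v n \<Longrightarrow> 0 < x \<bullet> (Q *\<^sub>v x)"
  using spd by (auto simp: sym_pos_def_def)

lemma dim_Q [simp]: "dim_row Q = n" "dim_col Q = n"
  using carrier_Q by (blast dest: carrier_matD)+

lemma sym_Q: "i < n \<Longrightarrow> j < n \<Longrightarrow> Q $$ (i, j) = Q $$ (j, i)"
  by (metis dim_Q index_transpose_mat(1) transpose_Q)

lemma Q_mult_carrier [simp]: "x \<in> carrier_vec n \<Longrightarrow> Q *\<^sub>v x \<in> carrier_vec n"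
  by (rule mult_mat_vec_carrier[OF carrier_Q])

lemma zero_mat_mult [simp]: "y \<in> carrier_vec n \<Longrightarrow> 0\<^sub>m n n *\<^sub>v y = (0\<^sub>v n :: real vec)"
  by (intro eq_vecI) auto

lemma symmetric_scalar_prod:
  assumes "A \<in> carrier_mat n n" "transpose_mat A = A" "x \<in> carrier_vec n" "y \<in> carrier_vec n"
  shows "x \<bullet> (A *\<^sub>v y) = (A *\<^sub>v x) \<bullet> (y :: real vec)"
  using transpose_vec_mult_scalar[OF assms(1,4,3)] assms(2) by simp

definition supported :: "real vec \<Rightarrow> nat set \<Rightarrow> bool" where
  "supported x S \<longleftrightarrow> (\<forall>j<n. j \<notin> S \<longrightarrow> x $ j = 0)"

text \<open>\<open>W\<close> is the inverse of the principal submatrix of \<open>Q\<close> on \<open>S\<close>, padded with zeros.\<close>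

definition padded_inverse :: "nat set \<Rightarrow> real mat \<Rightarrow> bool" where
  "padded_inverse S W \<longleftrightarrow> W \<in> carrier_mat n n \<and> transpose_mat W = W \<and>
     (\<forall>y \<in> carrier_vec n. supported (W *\<^sub>v y) S) \<and>
     (\<forall>x \<in> carrier_vec n. supported x S \<longrightarrow> W *\<^sub>v (Q *\<^sub>v x) = x)"

text \<open>The transition vector before scaling. On \<open>insert i S\<close> its image under
  \<open>Q\<close> is \<open>pivot W i\<close> times the unit vector at \<open>i\<close>.\<close>

definition pivot_vec :: "real mat \<Rightarrow> nat \<Rightarrow> real vec" where
  "pivot_vec W i = - (W *\<^sub>v col Q i) + unit_vec n i"

text \<open>The Schur complement of the \<open>S\<close>-block in the principal submatrix on
  \<open>insert i S\<close>, when \<open>W\<close> is the padded inverse for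
  \<open>S\<close>.\<close>

definition pivot :: "real mat \<Rightarrow> nat \<Rightarrow> real" where
  "pivot W i = Q $$ (i, i) - col Q i \<bullet> (W *\<^sub>v col Q i)"

lemma transition_vec_eq: "transition_vec Q W i = (1 / sqrt (pivot W i)) \<cdot>\<^sub>v pivot_vec W i"
  by (simp add: transition_vec_def pivot_vec_def pivot_def)

lemma Q_unit: "i < n \<Longrightarrow> Q *\<^sub>v unit_vec n i = col Q i"
  by (intro eq_vecI) auto

context
  fixes S W i
  assumes W: "padded_inverse S W" and S: "S \<subseteq> {..<i}" and i: "i < n"
begin

lemma W_carrier [simp]: "W \<in> carrier_mat n n" "dim_row W = n" "dim_col W = n"
  and W_sym: "transpose_mat W = W"
  and W_supported: "y \<in> carrier_vec n \<Longrightarrow> supported (W *\<^sub>v y) S"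
  and W_inverse: "x \<in> carrier_vec n \<Longrightarrow> supported x S \<Longrightarrow> W *\<^sub>v (Q *\<^sub>v x) = x"
  using W by (auto simp: padded_inverse_def)

lemma col_carrier [simp]: "col Q i \<in> carrier_vec n"
  by (metis carrier_Q col_carrier_vec i)

lemma Wq_carrier [simp]: "W *\<^sub>v col Q i \<in> carrier_vec n"
  by (rule mult_mat_vec_carrier[OF W_carrier(1) col_carrier])

lemma pivot_vec_carrier [simp]: "pivot_vec W i \<in> carrier_vec n"
  by (simp add: pivot_vec_def)

lemma dim_pivot_vec [simp]: "dim_vec (pivot_vec W i) = n"
  by (rule carrier_vecD[OF pivot_vec_carrier])

lemma pivot_vec_supported: "supported (pivot_vec W i) (insert i S)"
  using W_supported[of "col Q i"] i
  by (auto simp: supported_def pivot_vec_def simp del: index_mult_mat_vec)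

lemma pivot_vec_i: "pivot_vec W i $ i = 1"
  using W_supported[of "col Q i"] i S
  by (auto simp: supported_def pivot_vec_def simp del: index_mult_mat_vec)

lemma Q_pivot_vec: "Q *\<^sub>v pivot_vec W i = - (Q *\<^sub>v (W *\<^sub>v col Q i)) + col Q i"
proof -
  have "Q *\<^sub>v pivot_vec W i = Q *\<^sub>v (- (W *\<^sub>v col Q i)) + Q *\<^sub>v unit_vec n i"
    unfolding pivot_vec_def by (rule mult_add_distrib_mat_vec[of _ n n]) auto
  also have "Q *\<^sub>v (- (W *\<^sub>v col Q i)) = - (Q *\<^sub>v (W *\<^sub>v col Q i))"
    using i by (intro eq_vecI) (auto simp del: index_mult_mat_vec simp add: index_mult_mat_vec[of _ Q] scalar_prod_uminus_right)
  finally show ?thesis using Q_unit[OF i] by simp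
qed

lemma Q_pivot_vec_index:
  assumes "j < n"
  shows "(Q *\<^sub>v pivot_vec W i) $ j = Q $$ (j, i) - (Q *\<^sub>v unit_vec n j) \<bullet> (W *\<^sub>v col Q i)"
proof -
  have "(Q *\<^sub>v (W *\<^sub>v col Q i)) $ j = unit_vec n j \<bullet> (Q *\<^sub>v (W *\<^sub>v col Q i))"
    using assms by (intro scalar_prod_left_unit[symmetric]) auto
  also have "\<dots> = (Q *\<^sub>v unit_vec n j) \<bullet> (W *\<^sub>v col Q i)"
    by (rule symmetric_scalar_prod) (auto simp: transpose_Q)
  finally show ?thesis unfolding Q_pivot_vec using assms i by (simp del: index_mult_mat_vec)
qed

lemma Q_pivot_vec_i: "(Q *\<^sub>v pivot_vec W i) $ i = pivot W i"
  unfolding Q_pivot_vec_index[OF i] Q_unit[OF i] pivot_def ..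

text \<open>For \<open>j\<close> in \<open>S\<close>, \<open>W\<close> undoes \<open>Q\<close> on
  the unit vector at \<open>j\<close>, so by symmetry the subtracted term equals
  \<open>Q $$ (j, i)\<close>.\<close>

lemma Q_pivot_vec_S:
  assumes "j \<in> S"
  shows "(Q *\<^sub>v pivot_vec W i) $ j = 0"
proof -
  have j: "j < n" using assms S i by auto
  have "(Q *\<^sub>v unit_vec n j) \<bullet> (W *\<^sub>v col Q i) = (W *\<^sub>v (Q *\<^sub>v unit_vec n j)) \<bullet> col Q i"
    by (rule symmetric_scalar_prod) (auto simp: W_sym)
  also have "W *\<^sub>v (Q *\<^sub>v unit_vec n j) = unit_vec n j"
    by (rule W_inverse) (use assms j in \<open>auto simp: supported_def\<close>)
  finally show ?thesis
    unfolding Q_pivot_vec_index[OF j] using j i sym_Q by (simp add: scalar_prod_left_unit[of _ n])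
qed

lemma pivot_pairing:
  assumes "x \<in> carrier_vec n" "supported x (insert i S)"
  shows "pivot_vec W i \<bullet> (Q *\<^sub>v x) = x $ i * pivot W i"
proof -
  have "pivot_vec W i \<bullet> (Q *\<^sub>v x) = (Q *\<^sub>v pivot_vec W i) \<bullet> x"
    by (rule symmetric_scalar_prod) (auto simp: transpose_Q assms)
  also have "\<dots> = (\<Sum>j\<in>{0..<n}. (Q *\<^sub>v pivot_vec W i) $ j * x $ j)"
    using assms by (simp add: scalar_prod_def)
  also have "\<dots> = (\<Sum>j\<in>{i}. (Q *\<^sub>v pivot_vec W i) $ j * x $ j)"
  proof (rule sum.mono_neutral_right)
    show "\<forall>j\<in>{0..<n} - {i}. (Q *\<^sub>v pivot_vec W i) $ j * x $ j = 0"
    proof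
      fix j assume "j \<in> {0..<n} - {i}"
      then show "(Q *\<^sub>v pivot_vec W i) $ j * x $ j = 0"
        using Q_pivot_vec_S[of j] assms(2) by (cases "j \<in> S") (auto simp: supported_def)
    qed
  qed (use i in auto)
  finally show ?thesis by (simp add: Q_pivot_vec_i del: index_mult_mat_vec)
qed

text \<open>The pivot is the value of the form of \<open>Q\<close> at the pivot vector, whose entry
  at \<open>i\<close> is 1. So the square root and the division in the transition vector are
  proper.\<close>

lemma pivot_pos: "0 < pivot W i"
proof -
  have "pivot_vec W i \<noteq> 0\<^sub>v n" using pivot_vec_i i by auto
  then have "0 < pivot_vec W i \<bullet> (Q *\<^sub>v pivot_vec W i)" by (intro form_pos) auto
  then show ?thesis using pivot_pairing[OF _ pivot_vec_supported] by (simp add: pivot_vec_i)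
qed

lemma transition_vec_carrier [simp]: "transition_vec Q W i \<in> carrier_vec n"
  by (simp add: transition_vec_eq)

lemma dim_transition_vec [simp]: "dim_vec (transition_vec Q W i) = n"
  by (rule carrier_vecD[OF transition_vec_carrier])

lemma outer_prod_mult:
  assumes "u \<in> carrier_vec n" "z \<in> carrier_vec n"
  shows "outer_prod u u *\<^sub>v z = (u \<bullet> z) \<cdot>\<^sub>v u"
  using assms by (intro eq_vecI) (auto simp: outer_prod_def scalar_prod_def sum_distrib_left sum_distrib_right mult_ac)

lemma outer_prod_carrier: "u \<in> carrier_vec n \<Longrightarrow> outer_prod u u \<in> carrier_mat n n"
  by (auto simp: outer_prod_def)

lemma update_mult:
  assumes "z \<in> carrier_vec n"
  shows "phi_full Q W i True *\<^sub>v z =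
    W *\<^sub>v z + (transition_vec Q W i \<bullet> z) \<cdot>\<^sub>v transition_vec Q W i"
  using assms unfolding phi_full_def
  by (simp add: add_mult_distrib_mat_vec[of _ n n] outer_prod_carrier outer_prod_mult)

text \<open>Block inversion as a rank-one update. With \<open>y\<close> the pivot vector,
  \<open>x\<close> splits into \<open>z = x - x_i y\<close>, supported on \<open>S\<close> and fixed
  by \<open>W Q\<close>, and \<open>x_i y\<close>, which \<open>W Q\<close> kills and the rank-one
  term restores.\<close>

lemma padded_inverse_update: "padded_inverse (insert i S) (phi_full Q W i True)"
  unfolding padded_inverse_def
proof (intro conjI ballI impI)
  let ?W = "phi_full Q W i True" and ?u = "transition_vec Q W i"
  have oc: "outer_prod ?u ?u \<in> carrier_mat n n" by (rule outer_prod_carrier) simp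
  show c: "?W \<in> carrier_mat n n" using oc by (simp add: phi_full_def)
  have "transpose_mat (outer_prod ?u ?u) = outer_prod ?u ?u"
    by (intro eq_matI) (auto simp: outer_prod_def mult.commute)
  then show "transpose_mat ?W = ?W"
    using oc by (simp add: phi_full_def transpose_add[of _ n n] W_sym)
  fix y :: "real vec" assume y: "y \<in> carrier_vec n"
  show "supported (?W *\<^sub>v y) (insert i S)"
    unfolding update_mult[OF y] supported_def
  proof (intro allI impI)
    fix j assume j: "j < n" "j \<notin> insert i S"
    have "(W *\<^sub>v y) $ j = 0" using W_supported[OF y] j by (auto simp: supported_def)
    moreover have "?u $ j = 0"
      unfolding transition_vec_eq
      using pivot_vec_supported j by (simp add: supported_def)
    ultimately show "(W *\<^sub>v y + (?u \<bullet> y) \<cdot>\<^sub>v ?u) $ j = 0"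
      using j(1) by (simp del: index_mult_mat_vec)
  qed
next
  let ?W = "phi_full Q W i True" and ?u = "transition_vec Q W i" and ?y = "pivot_vec W i"
  fix x :: "real vec" assume x: "x \<in> carrier_vec n" "supported x (insert i S)"
  have Qx: "Q *\<^sub>v x \<in> carrier_vec n" using x by (intro mult_mat_vec_carrier[OF carrier_Q])
  define z where "z = x - x $ i \<cdot>\<^sub>v ?y"
  have z: "z \<in> carrier_vec n" using x(1) by (simp add: z_def)
  have "supported z S"
    unfolding supported_def
  proof (intro allI impI)
    fix j assume j: "j < n" "j \<notin> S"
    have dy: "dim_vec ?y = n" by (rule carrier_vecD[OF pivot_vec_carrier])
    show "z $ j = 0"
    proof (cases "j = i")
      case True
      then show ?thesis using pivot_vec_i i x(1) dy by (simp add: z_def)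
    next
      case False
      then show ?thesis using j pivot_vec_supported x dy by (auto simp: z_def supported_def)
    qed
  qed
  then have Wz: "W *\<^sub>v (Q *\<^sub>v z) = z" using z by (intro W_inverse)
  have "W *\<^sub>v (Q *\<^sub>v ?y) = - (W *\<^sub>v (Q *\<^sub>v (W *\<^sub>v col Q i))) + W *\<^sub>v col Q i"
    unfolding Q_pivot_vec by (subst mult_add_distrib_mat_vec[of _ n n]) auto
  also have "W *\<^sub>v (Q *\<^sub>v (W *\<^sub>v col Q i)) = W *\<^sub>v col Q i"
    by (intro W_inverse W_supported) auto
  finally have Wy: "W *\<^sub>v (Q *\<^sub>v ?y) = 0\<^sub>v n"
    using uminus_l_inv_vec[OF Wq_carrier] by simp
  have "x = z + x $ i \<cdot>\<^sub>v ?y" using x(1) carrier_vecD[OF pivot_vec_carrier] by (intro eq_vecI) (auto simp: z_def)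
  then have "W *\<^sub>v (Q *\<^sub>v x) = W *\<^sub>v (Q *\<^sub>v (z + x $ i \<cdot>\<^sub>v ?y))" by simp
  also have "\<dots> = W *\<^sub>v (Q *\<^sub>v z) + x $ i \<cdot>\<^sub>v (W *\<^sub>v (Q *\<^sub>v ?y))"
    using z by (simp add: mult_add_distrib_mat_vec[of _ n n] mult_mat_vec[of _ n n])
  also have "\<dots> = z" unfolding Wz Wy using z by (intro eq_vecI) auto
  finally have Wx: "W *\<^sub>v (Q *\<^sub>v x) = z" .
  have "?u \<bullet> (Q *\<^sub>v x) = (1 / sqrt (pivot W i)) * (?y \<bullet> (Q *\<^sub>v x))"
    unfolding transition_vec_eq by (rule smult_scalar_prod_distrib[of _ n]) (use Qx in auto)
  \<comment> \<open>The remaining square root cancels against the scaling of the second factor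
    \<open>?u\<close>.\<close>
  also have "\<dots> = x $ i * sqrt (pivot W i)"
    unfolding pivot_pairing[OF x] using pivot_pos by (simp add: real_div_sqrt flip: times_divide_eq_right)
  finally have "(?u \<bullet> (Q *\<^sub>v x)) \<cdot>\<^sub>v ?u = x $ i \<cdot>\<^sub>v ?y"
    unfolding transition_vec_eq using pivot_pos by (simp add: smult_smult_assoc)
  then show "?W *\<^sub>v (Q *\<^sub>v x) = x"
    unfolding update_mult[OF Qx] Wx using x(1) by (intro eq_vecI) (auto simp: z_def)
qed

text \<open>
  Up to scaling, the transition vector is the last column of the inverse of the principal
  submatrix of \<open>Q\<close> on \<open>insert i S\<close>.
\<close>

lemma transition_vec_quotient:
  fixes d :: "real vec"
  assumes d: "d \<in> carrier_vec n"
  obtains v where "\<And>j. j \<in> insert i S \<Longrightarrow> app (insert i S) (entries Q) v j = of_bool (j = i)"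
    and "(d \<bullet> transition_vec Q W i)\<^sup>2 = (ip (insert i S) (($) d) v)\<^sup>2 / v i"
proof -
  let ?T = "insert i S" and ?s = "pivot W i" and ?y = "pivot_vec W i"
  define v where "v = (\<lambda>j. (1 / ?s) * ?y $ j)"
  have T: "?T \<subseteq> {..<n}" using S i by auto
  have y0: "?y $ j = 0" if "j \<in> {..<n} - ?T" for j
    using that pivot_vec_supported by (auto simp: supported_def)
  have "app ?T (entries Q) (($) ?y) j = (if j = i then ?s else 0)" if "j \<in> ?T" for j
  proof -
    have "app ?T (entries Q) (($) ?y) j = app {..<n} (entries Q) (($) ?y) j"
      unfolding app_def by (rule sum.mono_neutral_left) (use T y0 in auto)
    also have "\<dots> = (Q *\<^sub>v ?y) $ j"
      by (rule mult_mat_vec_eq_app[symmetric]) (use that T in auto)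
    finally show ?thesis using that Q_pivot_vec_S[of j] Q_pivot_vec_i by auto
  qed
  then have 1: "app ?T (entries Q) v j = of_bool (j = i)" if "j \<in> ?T" for j
    unfolding v_def app_scale using that pivot_pos by simp
  have "d \<bullet> transition_vec Q W i = (1 / sqrt ?s) * (d \<bullet> ?y)"
    unfolding transition_vec_eq by (rule scalar_prod_smult_distrib[of _ n]) (use d in auto)
  also have "d \<bullet> ?y = ip ?T (($) d) (($) ?y)"
    unfolding scalar_prod_eq_ip[OF pivot_vec_carrier] ip_def
    by (rule sum.mono_neutral_right) (use T y0 in auto)
  finally have "(d \<bullet> transition_vec Q W i)\<^sup>2 = (ip ?T (($) d) (($) ?y))\<^sup>2 / ?s"
    using pivot_pos by (simp add: power_divide)
  also have "\<dots> = (ip ?T (($) d) v)\<^sup>2 / v i"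
    using pivot_pos unfolding v_def ip_scale_right pivot_vec_i
    by (simp add: power_mult_distrib power2_eq_square field_simps)
  finally show ?thesis using 1 that by blast
qed

end

lemma padded_inverse_node:
  "length p \<le> n \<Longrightarrow> padded_inverse (ones p) (snd (node Q p))"
proof (induction p rule: rev_induct)
  case Nil
  have z: "0\<^sub>v n = x" if "x \<in> carrier_vec n" "\<forall>j<n. x $ j = 0" for x :: "real vec"
    using that by (intro eq_vecI) auto
  show ?case
    using z by (auto simp: padded_inverse_def node_Nil ones_def supported_def)
next
  case (snoc b p)
  then have IH: "padded_inverse (ones p) (snd (node Q p))" and l: "length p < n" by simp_all
  show ?case
    using padded_inverse_update[OF IH ones_subset l] IH
    by (cases b) (simp_all add: ones_snoc node_snoc dd_state_def phi_full_def)
qed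

lemma node_transition_quotient:
  fixes d :: "real vec"
  assumes d: "d \<in> carrier_vec n" and p: "length p < n"
  defines "T \<equiv> insert (length p) (ones p)"
  obtains v where "\<And>j. j \<in> T \<Longrightarrow> app T (entries Q) v j = of_bool (j = length p)"
    and "(d \<bullet> transition_vec Q (snd (node Q p)) (length p))\<^sup>2 = (ip T (($) d) v)\<^sup>2 / v (length p)"
  using transition_vec_quotient[OF padded_inverse_node _ p d, of p] that p
  by (auto simp: T_def ones_def)

lemma form_node_snoc:
  assumes d: "d \<in> carrier_vec n" and p: "length p < n"
  shows "d \<bullet> (snd (node Q (p @ [b])) *\<^sub>v d) =
    d \<bullet> (snd (node Q p) *\<^sub>v d) + (d \<bullet> arc_vec Q (node Q p, b))\<^sup>2"
proof (cases b)
  case True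
  let ?W = "snd (node Q p)" and ?u = "transition_vec Q (snd (node Q p)) (length p)"
  have W: "padded_inverse (ones p) ?W" using padded_inverse_node p by simp
  have S: "ones p \<subseteq> {..<length p}" by (auto simp: ones_def)
  note W' = W S p
  have u: "?u \<in> carrier_vec n" by (rule transition_vec_carrier[OF W'])
  have Wd: "?W *\<^sub>v d \<in> carrier_vec n" using W_carrier(1)[OF W'] d by (rule mult_mat_vec_carrier)
  have "snd (node Q (p @ [b])) *\<^sub>v d = ?W *\<^sub>v d + (?u \<bullet> d) \<cdot>\<^sub>v ?u"
    using update_mult[OF W' d] True by (simp add: node_snoc dd_state_def)
  then have "d \<bullet> (snd (node Q (p @ [b])) *\<^sub>v d) = d \<bullet> (?W *\<^sub>v d) + (?u \<bullet> d) * (d \<bullet> ?u)"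
    using d u Wd by (simp add: scalar_prod_add_distrib[of _ n])
  then show ?thesis using True d u by (simp add: arc_vec_def power2_eq_square comm_scalar_prod[of _ n])
next
  case False
  then show ?thesis using d by (simp add: node_snoc dd_state_def phi_full_def arc_vec_def)
qed

text \<open>Each arc adds its squared term to the form of the stored matrix, so the sum telescopes
  from the zero matrix at the root.\<close>

lemma form_node:
  assumes d: "d \<in> carrier_vec n"
  shows "length p \<le> n \<Longrightarrow>
    d \<bullet> (snd (node Q p) *\<^sub>v d) = (\<Sum>i<length p. (d \<bullet> arc_vec Q (node Q (take i p), p ! i))\<^sup>2)"
proof (induction p rule: rev_induct)
  case Nil
  then show ?case using d by (simp add: node_Nil)
next
  case (snoc b p)
  have "(\<Sum>i<length p. (d \<bullet> arc_vec Q (node Q (take i (p @ [b])), (p @ [b]) ! i))\<^sup>2) =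
      (\<Sum>i<length p. (d \<bullet> arc_vec Q (node Q (take i p), p ! i))\<^sup>2)"
    by (intro sum.cong refl) (simp add: nth_append)
  then show ?case using snoc form_node_snoc[OF d, of p b] by simp
qed

section \<open>Path lengths without merging and the quadratic program\<close>

definition exact_cost :: "real vec \<Rightarrow> real vec \<Rightarrow> bool list \<Rightarrow> real" where
  "exact_cost c d p = (\<Sum>i<length p. arc_length Q c d (node Q (take i p), p ! i))"

lemma exact_cost_eq:
  assumes "d \<in> carrier_vec n" "length p = n"
  shows "exact_cost c d p = (\<Sum>i<n. c $ i * of_bool (p ! i)) - 1 / 2 * (d \<bullet> (snd (node Q p) *\<^sub>v d))"
proof -
  have "exact_cost c d p = (\<Sum>i<n. c $ i * of_bool (p ! i) - 1 / 2 * (d \<bullet> arc_vec Q (node Q (take i p), p ! i))\<^sup>2)"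
    unfolding exact_cost_def assms(2) arc_length_def
    by (intro sum.cong refl) (use assms(2) in simp)
  then show ?thesis
    using form_node[OF assms(1), of p] assms(2) by (simp add: sum_subtractf sum_divide_distrib)
qed

text \<open>For fixed support the minimiser is \<open>- W d\<close>; completing the square there
  leaves a constant equal to the exact path length.\<close>

lemma objective_completed_square:
  assumes W: "padded_inverse S W" and c: "d \<in> carrier_vec n" and x: "x \<in> carrier_vec n" "supported x S"
  shows "objective Q c d (x, z) =
    c \<bullet> z - 1 / 2 * (d \<bullet> (W *\<^sub>v d)) + 1 / 2 * ((x + W *\<^sub>v d) \<bullet> (Q *\<^sub>v (x + W *\<^sub>v d)))"
proof -
  let ?w = "W *\<^sub>v d"
  have Wc: "W \<in> carrier_mat n n" and Ws: "transpose_mat W = W"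
    and sup: "supported ?w S" and inv: "\<And>x. x \<in> carrier_vec n \<Longrightarrow> supported x S \<Longrightarrow> W *\<^sub>v (Q *\<^sub>v x) = x"
    using W c by (auto simp: padded_inverse_def)
  have w: "?w \<in> carrier_vec n" using Wc c by (rule mult_mat_vec_carrier)
  have Qc: "Q *\<^sub>v y \<in> carrier_vec n" if "y \<in> carrier_vec n" for y
    using that by (intro mult_mat_vec_carrier[OF carrier_Q])
  \<comment> \<open>\<open>Q W d\<close> and \<open>d\<close> agree when paired with vectors
    supported on \<open>S\<close>: both symmetric matrices move to the other side, where
    \<open>W Q\<close> fixes \<open>y\<close>.\<close>
  have pair: "y \<bullet> (Q *\<^sub>v ?w) = d \<bullet> y" if y: "y \<in> carrier_vec n" "supported y S" for y
  proof -
    have "y \<bullet> (Q *\<^sub>v ?w) = (Q *\<^sub>v y) \<bullet> (W *\<^sub>v d)"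
      by (rule symmetric_scalar_prod) (use y w in \<open>auto simp: transpose_Q\<close>)
    also have "\<dots> = (W *\<^sub>v (Q *\<^sub>v y)) \<bullet> d"
      by (rule symmetric_scalar_prod) (use Qc y c Wc Ws in auto)
    finally show ?thesis using inv[OF y] y c by (simp add: comm_scalar_prod[of _ n])
  qed
  have "(x + ?w) \<bullet> (Q *\<^sub>v (x + ?w)) = (x + ?w) \<bullet> (Q *\<^sub>v x + Q *\<^sub>v ?w)"
    using x w by (simp add: mult_add_distrib_mat_vec[of _ n n])
  also have "\<dots> = x \<bullet> (Q *\<^sub>v x) + x \<bullet> (Q *\<^sub>v ?w) + (?w \<bullet> (Q *\<^sub>v x) + ?w \<bullet> (Q *\<^sub>v ?w))"
    using x w Qc by (simp add: scalar_prod_add_distrib[of _ n] add_scalar_prod_distrib[of _ n])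
  also have "?w \<bullet> (Q *\<^sub>v x) = x \<bullet> (Q *\<^sub>v ?w)"
    using symmetric_scalar_prod[OF carrier_Q transpose_Q w x(1)] comm_scalar_prod[OF x(1) Qc[OF w]] by simp
  finally have "(x + ?w) \<bullet> (Q *\<^sub>v (x + ?w)) = x \<bullet> (Q *\<^sub>v x) + 2 * (d \<bullet> x) + d \<bullet> ?w"
    using pair[OF x] pair[OF w sup] by simp
  then show ?thesis by (simp add: objective_def field_simps)
qed

definition word_vec :: "bool list \<Rightarrow> real vec" where
  "word_vec p = vec n (\<lambda>i. of_bool (p ! i))"

lemma scalar_prod_word_vec: "c \<bullet> word_vec p = (\<Sum>i<n. c $ i * of_bool (p ! i))"
  by (simp add: word_vec_def scalar_prod_def atLeast0LessThan)

lemma exact_cost_attained: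
  assumes d: "d \<in> carrier_vec n" and p: "length p = n"
  shows "exact_cost c d p \<in> objective Q c d ` feasible n"
proof -
  let ?W = "snd (node Q p)"
  have W: "padded_inverse (ones p) ?W" using padded_inverse_node p by simp
  then have Wc: "?W \<in> carrier_mat n n" and sup: "supported (?W *\<^sub>v d) (ones p)"
    using d by (auto simp: padded_inverse_def)
  define x where "x = - (?W *\<^sub>v d)"
  have w: "?W *\<^sub>v d \<in> carrier_vec n" using Wc d by (rule mult_mat_vec_carrier)
  have x: "x \<in> carrier_vec n" "supported x (ones p)"
    using w sup carrier_vecD[OF w]
    by (auto simp: x_def supported_def simp del: index_mult_mat_vec dim_mult_mat_vec)
  have "x + ?W *\<^sub>v d = 0\<^sub>v n" unfolding x_def by (rule uminus_l_inv_vec[OF w])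
  then have "objective Q c d (x, word_vec p) = exact_cost c d p"
    unfolding objective_completed_square[OF W d x] exact_cost_eq[OF d p] scalar_prod_word_vec
    by (simp add: mult_mat_vec_carrier[OF carrier_Q])
  moreover have "(x, word_vec p) \<in> feasible n"
    using x p by (auto simp: feasible_def word_vec_def supported_def ones_def)
  ultimately show ?thesis by (metis imageI)
qed

text \<open>The word is read off from \<open>z\<close>, and the completed square is
  nonnegative.\<close>

lemma exact_cost_lower_bound:
  assumes d: "d \<in> carrier_vec n" and f: "(x, z) \<in> feasible n"
  obtains p where "length p = n" "exact_cost c d p \<le> objective Q c d (x, z)"
proof -
  define p where "p = map (\<lambda>i. z $ i = 1) [0..<n]"
  have p: "length p = n" by (simp add: p_def)
  have fx: "x \<in> carrier_vec n" "z \<in> carrier_vec n" "\<And>i. i < n \<Longrightarrow> z $ i = 0 \<or> z $ i = 1"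
    "\<And>i. i < n \<Longrightarrow> x $ i * (1 - z $ i) = 0"
    using f by (auto simp: feasible_def)
  have z: "z = word_vec p" using fx(2,3) by (intro eq_vecI) (auto simp: word_vec_def p_def)
  have x: "supported x (ones p)" using fx(4) by (auto simp: supported_def ones_def p_def)
  let ?W = "snd (node Q p)"
  have W: "padded_inverse (ones p) ?W" using padded_inverse_node p by simp
  then have w: "?W *\<^sub>v d \<in> carrier_vec n"
    using d by (auto simp: padded_inverse_def intro: mult_mat_vec_carrier[of _ n n])
  have "0 \<le> y \<bullet> (Q *\<^sub>v y)" if "y \<in> carrier_vec n" for y
    using form_pos[OF that] that by (cases "y = 0\<^sub>v n") (auto simp: mult_mat_vec_carrier[OF carrier_Q] less_imp_le)
  from this[of "x + ?W *\<^sub>v d"] have "exact_cost c d p \<le> objective Q c d (x, z)"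
    unfolding objective_completed_square[OF W d fx(1) x] exact_cost_eq[OF d p] z scalar_prod_word_vec
    using fx(1) w by simp
  with p that show ?thesis by blast
qed

end

subsection \<open>Paths in the truncated diagram\<close>

text \<open>The word of the representative into whose class \<open>p\<close> is merged.\<close>

definition truncate_word :: "nat \<Rightarrow> bool list \<Rightarrow> bool list" where
  "truncate_word m p = replicate (length p - m) False @ drop (length p - m) p"

lemma length_truncate_word [simp]: "length (truncate_word m p) = length p"
  by (simp add: truncate_word_def)

lemma truncate_word_Nil [simp]: "truncate_word m [] = []"
  by (simp add: truncate_word_def)

lemma nth_truncate_word: "j < length p \<Longrightarrow> truncate_word m p ! j = (length p \<le> j + m \<and> p ! j)"
  by (auto simp: truncate_word_def nth_append)

lemma ones_truncate_word: "ones (truncate_word m p) = {j \<in> ones p. length p \<le> j + m}"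
  by (auto simp: ones_def nth_truncate_word)

text \<open>Merging in every layer has the same effect as a single truncation of the full history:
  what is forgotten early would be forgotten later anyway.\<close>

lemma truncate_word_snoc: "truncate_word m (truncate_word m p @ [b]) = truncate_word m (p @ [b])"
  by (rule nth_equalityI) (auto simp: nth_truncate_word nth_append)

lemma old_values_zero_truncate_word: "old_values_zero m (truncate_word m p)"
  by (auto simp: old_values_zero_def truncate_word_def)

lemma truncate_word_unique:
  assumes "same_recent m q p" "old_values_zero m p"
  shows "p = truncate_word m q"
proof -
  have l: "length q = length p" and d: "drop (length q - m) q = drop (length p - m) p"
    using assms(1) unfolding same_recent_def by blast+
  have "take (length p - m) p = replicate (length p - m) False"
  proof (rule replicate_eqI)
    fix y assume "y \<in> set (take (length p - m) p)"
    then show "y = False" using assms(2) by (auto simp: old_values_zero_def)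
  qed simp
  then show ?thesis unfolding truncate_word_def using l d by (metis append_take_drop_id)
qed

lemma dd_merge_props:
  assumes "s \<in> dd_states Q (dd_layer Q m i)"
  shows "dd_merge m (dd_states Q (dd_layer Q m i)) s \<in> dd_states Q (dd_layer Q m i)"
    and "fst (dd_merge m (dd_states Q (dd_layer Q m i)) s) = truncate_word m (fst s)"
proof -
  let ?r = "dd_merge m (dd_states Q (dd_layer Q m i)) s"
  have r: "?r \<in> dd_states Q (dd_layer Q m i) \<and> same_recent m (fst s) (fst ?r) \<and> old_values_zero m (fst ?r)"
    unfolding dd_merge_def by (rule theI', rule dd_merge_unique[OF assms])
  then show "?r \<in> dd_states Q (dd_layer Q m i)" by blast
  show "fst ?r = truncate_word m (fst s)" using r truncate_word_unique by blast
qed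

text \<open>Merging selects an existing state and never alters a matrix, so the stored matrix is
  determined by the stored word.\<close>

lemma layer_node: "v \<in> dd_layer Q m i \<Longrightarrow> v = node Q (fst v)"
proof (induction i arbitrary: v)
  case 0
  then show ?case by (simp add: node_Nil)
next
  case (Suc i)
  then have "v \<in> dd_states Q (dd_layer Q m i)" using dd_merge_props(1) by auto
  then obtain w b where "w \<in> dd_layer Q m i" "v = dd_state Q w b" by (auto simp: dd_states_def)
  then show ?case using Suc.IH[of w] node_snoc[of Q "fst w" b] by (simp add: dd_state_def)
qed

lemma truncated_node_in_layer: "node Q (truncate_word m p) \<in> dd_layer Q m (length p)"
proof -
  have "truncate_word m p \<in> fst ` dd_layer Q m (length p)"
    using dd_layer_words[of Q m "length p"] old_values_zero_truncate_word[of m p] by simp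
  then show ?thesis using layer_node by force
qed

lemma layer_length: "v \<in> dd_layer Q m i \<Longrightarrow> length (fst v) = i"
  using dd_layer_words[of Q m i] by blast

lemma head_truncated_dd:
  "head (truncated_dd n Q m) (node Q (truncate_word m p), b) = node Q (truncate_word m (p @ [b]))"
proof -
  let ?s = "dd_state Q (node Q (truncate_word m p)) b"
  let ?r = "dd_merge m (dd_states Q (dd_layer Q m (length p))) ?s"
  have s: "?s \<in> dd_states Q (dd_layer Q m (length p))"
    unfolding dd_states_def using truncated_node_in_layer by blast
  have "?r \<in> dd_layer Q m (Suc (length p))" using s by simp
  then have "?r = node Q (fst ?r)" by (rule layer_node)
  also have "fst ?r = truncate_word m (p @ [b])"
    using dd_merge_props(2)[OF s] by (simp add: dd_state_def truncate_word_snoc)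
  finally show ?thesis by (simp add: truncated_dd_def)
qed

text \<open>\<open>q\<close> carries the complete history, including values that the nodes have
  forgotten.\<close>

fun dd_path :: "real mat \<Rightarrow> nat \<Rightarrow> bool list \<Rightarrow> bool list \<Rightarrow> (dd_node \<times> bool) list" where
  "dd_path Q m q [] = []"
| "dd_path Q m q (b # bs) = (node Q (truncate_word m q), b) # dd_path Q m (q @ [b]) bs"

lemma map_snd_dd_path [simp]: "map snd (dd_path Q m q p) = p"
  by (induction p arbitrary: q) auto

lemma length_dd_path [simp]: "length (dd_path Q m q p) = length p"
  by (induction p arbitrary: q) auto

text \<open>The start node and the value assignments determine all arcs, because the head of an arc
  is again the node of a truncated word.\<close>

lemma cas_dd_path:
  "pre_digraph.cas (truncated_dd n Q m) (node Q (truncate_word m q)) P t \<longleftrightarrow>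
     P = dd_path Q m q (map snd P) \<and> t = node Q (truncate_word m (q @ map snd P))"
proof (induction P arbitrary: q)
  case Nil
  then show ?case by (auto simp: pre_digraph.cas.simps)
next
  case (Cons e P)
  obtain v b where e: "e = (v, b)" by (cases e)
  have "tail (truncated_dd n Q m) e = v" by (simp add: truncated_dd_def e)
  then show ?case
    using Cons[of "q @ [b]"] by (auto simp: pre_digraph.cas.simps e head_truncated_dd)
qed

lemma dd_path_arcs:
  "length q + length p \<le> n \<Longrightarrow> set (dd_path Q m q p) \<subseteq> arcs (truncated_dd n Q m)"
proof (induction p arbitrary: q)
  case (Cons b p)
  have "(node Q (truncate_word m q), b) \<in> arcs (truncated_dd n Q m)"
    using truncated_node_in_layer[of Q m q] Cons.prems
    by (auto simp: truncated_dd_def intro!: exI[of _ "length q"])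
  then show ?case using Cons.IH[of "q @ [b]"] Cons.prems by simp
qed simp

text \<open>The layer numbers along a path increase by one, which makes its vertices distinct and
  the walk an \<open>apath\<close>.\<close>

lemma awalk_verts_dd_path:
  "map (\<lambda>v. length (fst v))
     (pre_digraph.awalk_verts (truncated_dd n Q m) (node Q (truncate_word m q)) (dd_path Q m q p)) =
   [length q..<Suc (length q + length p)]"
proof (induction p arbitrary: q)
  case Nil
  show ?case by (simp add: pre_digraph.awalk_verts.simps)
next
  case (Cons b p)
  have t: "tail (truncated_dd n Q m) (v, b) = v" for v by (simp add: truncated_dd_def)
  show ?case
    using Cons[of "q @ [b]"]
    by (simp add: pre_digraph.awalk_verts.simps head_truncated_dd t upt_conv_Cons[of "length q"] del: upt_Suc)
qed

lemma apath_truncated_dd_iff: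
  assumes Q: "dim_row Q = n"
  shows "t \<in> dd_layer Q m n \<and> pre_digraph.apath (truncated_dd n Q m) (dd_root n) P t \<longleftrightarrow>
    (\<exists>p. length p = n \<and> P = dd_path Q m [] p \<and> t = node Q (truncate_word m p))"
proof
  let ?G = "truncated_dd n Q m"
  have root: "dd_root n = node Q (truncate_word m [])"
    using Q by (simp add: dd_root_def node_Nil)
  {
    assume a: "t \<in> dd_layer Q m n \<and> pre_digraph.apath ?G (dd_root n) P t"
    then have "pre_digraph.cas ?G (node Q (truncate_word m [])) P t"
      by (simp add: pre_digraph.apath_def pre_digraph.awalk_def root)
    then have P: "P = dd_path Q m [] (map snd P)" and t: "t = node Q (truncate_word m (map snd P))"
      unfolding cas_dd_path by simp_all
    \<comment> \<open>The end lies in layer \<open>n\<close>, and the layer number is the length of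
      the word.\<close>
    have "length (map snd P) = n" using layer_length[of t Q m n] a t by simp
    with P t show "\<exists>p. length p = n \<and> P = dd_path Q m [] p \<and> t = node Q (truncate_word m p)"
      by blast
  next
    assume "\<exists>p. length p = n \<and> P = dd_path Q m [] p \<and> t = node Q (truncate_word m p)"
    then obtain p where p: "length p = n" and P: "P = dd_path Q m [] p" and t: "t = node Q (truncate_word m p)"
      by blast
    have "dd_root n \<in> verts ?G"
      using truncated_node_in_layer[of Q m "[]"] unfolding root by (auto simp: truncated_dd_def simp del: dd_layer.simps)
    moreover have "pre_digraph.cas ?G (dd_root n) P t"
      unfolding root cas_dd_path P t by simp
    moreover have "set P \<subseteq> arcs ?G" unfolding P by (rule dd_path_arcs) (simp add: p)
    moreover have "distinct (pre_digraph.awalk_verts ?G (dd_root n) P)"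
    proof -
      have "distinct (map (\<lambda>v. length (fst v)) (pre_digraph.awalk_verts ?G (dd_root n) P))"
        unfolding root P awalk_verts_dd_path by (rule distinct_upt)
      then show ?thesis by (simp only: distinct_map)
    qed
    ultimately show "t \<in> dd_layer Q m n \<and> pre_digraph.apath ?G (dd_root n) P t"
      using truncated_node_in_layer[of Q m p] p t
      by (simp add: pre_digraph.apath_def pre_digraph.awalk_def)
  }
qed

definition truncated_cost :: "real mat \<Rightarrow> real vec \<Rightarrow> real vec \<Rightarrow> nat \<Rightarrow> bool list \<Rightarrow> real" where
  "truncated_cost Q c d m p =
     (\<Sum>i<length p. arc_length Q c d (node Q (truncate_word m (take i p)), p ! i))"

lemma sum_list_dd_path:
  "sum_list (map f (dd_path Q m q p)) =
   (\<Sum>i<length p. f (node Q (truncate_word m (q @ take i p)), p ! i) :: real)"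
proof (induction p arbitrary: q)
  case (Cons b p)
  show ?case using Cons[of "q @ [b]"] by (simp add: sum.lessThan_Suc_shift del: sum.lessThan_Suc)
qed simp

lemma path_lengths_truncated_dd:
  assumes "dim_row Q = n"
  shows "{sum_list (map (arc_length Q c d) p) | p t.
      t \<in> dd_layer Q m n \<and> pre_digraph.apath (truncated_dd n Q m) (dd_root n) p t} =
    truncated_cost Q c d m ` {p. length p = n}"
proof -
  have "sum_list (map (arc_length Q c d) (dd_path Q m [] p)) = truncated_cost Q c d m p" for p
    by (simp add: sum_list_dd_path truncated_cost_def)
  then have "truncated_cost Q c d m ` {p. length p = n} =
      {sum_list (map (arc_length Q c d) (dd_path Q m [] p)) | p. length p = n}"
    by (simp add: image_Collect)
  then show ?thesis unfolding apath_truncated_dd_iff[OF assms] by blast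
qed

lemma finite_words: "finite {p :: bool list. length p = n}"
  using finite_lists_length_eq[of "UNIV :: bool set" n] by simp

lemma words_nonempty: "{p :: bool list. length p = n} \<noteq> {}"
  using Ex_list_of_length by auto

lemma is_minimum_Min:
  "finite S \<Longrightarrow> S \<noteq> {} \<Longrightarrow> is_minimum S (Min S)"
  by (simp add: is_minimum_def)

lemma shortest_path_truncated_dd:
  assumes "dim_row Q = n"
  shows "is_shortest_path_length n Q c d m (Min (truncated_cost Q c d m ` {p. length p = n}))"
  unfolding is_shortest_path_length_def path_lengths_truncated_dd[OF assms]
  by (rule is_minimum_Min) (use finite_words words_nonempty in auto)

text \<open>Each minimum is compared with the value of its function at the minimiser of the
  other.\<close>

lemma Min_image_diff_le:
  fixes f g :: "'a \<Rightarrow> real"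
  assumes "finite A" "A \<noteq> {}" "\<And>x. x \<in> A \<Longrightarrow> \<bar>f x - g x\<bar> \<le> e"
  shows "\<bar>Min (f ` A) - Min (g ` A)\<bar> \<le> e"
proof -
  have "Min (f ` A) \<in> f ` A" "Min (g ` A) \<in> g ` A" using assms by (auto intro!: Min_in)
  then obtain x y where xy: "x \<in> A" "Min (f ` A) = f x" "y \<in> A" "Min (g ` A) = g y" by blast
  have "Min (f ` A) \<le> f y" "Min (g ` A) \<le> g x" by (rule Min_le; use xy(1,3) assms(1) in blast)+
  then show ?thesis using xy assms(3)[of x] assms(3)[of y] by linarith
qed

section \<open>From the errors of arcs to the error of the optimal value\<close>

context spd
begin

text \<open>Every word's cost is a feasible value, and every feasible value is at least the cost of
  some word; finitely many words then give a minimum.\<close>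

lemma optimal_value_exact:
  assumes "d \<in> carrier_vec n"
  shows "is_optimal_value n Q c d (Min (exact_cost c d ` {p. length p = n}))"
  unfolding is_optimal_value_def is_minimum_def
proof
  let ?S = "exact_cost c d ` {p. length p = n}"
  have fin: "finite ?S" "?S \<noteq> {}" using finite_words words_nonempty by auto
  then have "Min ?S \<in> ?S" by (rule Min_in)
  then show "Min ?S \<in> objective Q c d ` feasible n" using exact_cost_attained[OF assms] by auto
  show "\<forall>s\<in>objective Q c d ` feasible n. Min ?S \<le> s"
  proof
    fix s assume "s \<in> objective Q c d ` feasible n"
    then obtain x z where "(x, z) \<in> feasible n" and s: "s = objective Q c d (x, z)" by auto
    then obtain p where "length p = n" "exact_cost c d p \<le> s"
      using exact_cost_lower_bound[OF assms] by metis
    then show "Min ?S \<le> s" using Min_le[OF fin(1), of "exact_cost c d p"] by auto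
  qed
qed

text \<open>The linear parts of corresponding arcs coincide, and arcs with value 0 have no squared
  term. The bound \<open>2 * e\<close> absorbs the factor \<open>1 / 2\<close> of the arc
  length.\<close>

lemma Min_cost_diff_le:
  fixes e :: real
  assumes e: "\<And>p. length p < n \<Longrightarrow>
      \<bar>(d \<bullet> transition_vec Q (snd (node Q p)) (length p))\<^sup>2 -
       (d \<bullet> transition_vec Q (snd (node Q (truncate_word m p))) (length p))\<^sup>2\<bar> \<le> 2 * e"
    and e0: "0 \<le> e"
  shows "\<bar>Min (truncated_cost Q c d m ` {p. length p = n}) - Min (exact_cost c d ` {p. length p = n})\<bar>
    \<le> n * e"
proof (rule Min_image_diff_le[OF finite_words words_nonempty])
  fix p :: "bool list" assume "p \<in> {p. length p = n}"
  then have p: "length p = n" by simp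
  have "\<bar>truncated_cost Q c d m p - exact_cost c d p\<bar> \<le>
      (\<Sum>i<n. \<bar>arc_length Q c d (node Q (truncate_word m (take i p)), p ! i) -
        arc_length Q c d (node Q (take i p), p ! i)\<bar>)"
    unfolding truncated_cost_def exact_cost_def p sum_subtractf[symmetric] by (rule sum_abs)
  also have "\<dots> \<le> (\<Sum>i<n. e)"
  proof (rule sum_mono)
    fix i assume "i \<in> {..<n}"
    then have l: "length (take i p) = i" "i < n" using p by auto
    show "\<bar>arc_length Q c d (node Q (truncate_word m (take i p)), p ! i) -
        arc_length Q c d (node Q (take i p), p ! i)\<bar> \<le> e"
      using e[of "take i p"] l e0 by (auto simp: arc_length_def arc_vec_def abs_le_iff)
  qed
  finally show "\<bar>truncated_cost Q c d m p - exact_cost c d p\<bar> \<le> n * e" by simp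
qed

text \<open>Polarisation at the sum of two unit vectors shows that \<open>Q\<close> is
  \<open>a\<close> times the identity.\<close>

lemma scalar_form_eq:
  assumes eq: "\<And>x. ip {..<n} x (app {..<n} (entries Q) x) = a * ip {..<n} x x"
    and "i < n" "j < n"
  shows "Q $$ (i, j) = (if i = j then a else 0)"
proof -
  let ?e = "\<lambda>i j. of_bool (j = i) :: real"
  have e: "ip {..<n} (?e i) (app {..<n} (entries Q) (?e j)) = Q $$ (i, j)" if "i < n" "j < n" for i j
    using that by (simp add: ip_indicator app_indicator)
  have diag: "Q $$ (l, l) = a" if "l < n" for l
    using eq[of "?e l"] e[OF that that] that by (simp add: ip_indicator)
  show ?thesis
  proof (cases "i = j")
    case False
    have "ip {..<n} (\<lambda>l. ?e i l + ?e j l) (app {..<n} (entries Q) (\<lambda>l. ?e i l + ?e j l)) =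
        Q $$ (i, i) + Q $$ (i, j) + (Q $$ (j, i) + Q $$ (j, j))"
      unfolding app_add ip_add_left ip_add_right using assms(2,3) by (simp only: e)
    moreover have "ip {..<n} (\<lambda>l. ?e i l + ?e j l) (\<lambda>l. ?e i l + ?e j l) = 2"
      unfolding ip_add_left ip_add_right using assms(2,3) False by (simp add: ip_indicator)
    ultimately show ?thesis using False eq[of "\<lambda>l. ?e i l + ?e j l"] diag assms(2,3) sym_Q[of i j] by simp
  qed (use diag assms(2) in simp)
qed

text \<open>When \<open>Q\<close> is a multiple of the identity, the column of the inverse is a
  scaled unit vector, so the arc term does not see the earlier values.\<close>

lemma scalar_transition:
  assumes eq: "\<And>x. ip {..<n} x (app {..<n} (entries Q) x) = a * ip {..<n} x x"
    and a: "a \<noteq> 0" and d: "d \<in> carrier_vec n" and p: "length p < n"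
  shows "(d \<bullet> transition_vec Q (snd (node Q p)) (length p))\<^sup>2 = (d $ length p)\<^sup>2 / a"
proof -
  let ?i = "length p" and ?T = "insert (length p) (ones p)"
  obtain v where v: "\<And>j. j \<in> ?T \<Longrightarrow> app ?T (entries Q) v j = of_bool (j = ?i)"
    "(d \<bullet> transition_vec Q (snd (node Q p)) ?i)\<^sup>2 = (ip ?T (($) d) v)\<^sup>2 / v ?i"
    using node_transition_quotient[OF d p] by blast
  have T: "?T \<subseteq> {..<n}" "finite ?T" using ones_subset[of p] p finite_subset by fastforce+
  have vj: "v j = of_bool (j = ?i) / a" if j: "j \<in> ?T" for j
  proof -
    have "app ?T (entries Q) v j = (\<Sum>l\<in>?T. if l = j then a * v l else 0)"
      unfolding app_def
    proof (rule sum.cong[OF refl])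
      fix l assume "l \<in> ?T"
      then have "j < n" "l < n" using j T(1) by blast+
      then show "Q $$ (j, l) * v l = (if l = j then a * v l else 0)"
        using scalar_form_eq[OF eq, of j l] by auto
    qed
    also have "\<dots> = a * v j" using T(2) j by (simp only: sum.delta if_True)
    finally have "a * v j = of_bool (j = ?i)" using v(1)[OF j] by simp
    then show ?thesis using a by (simp add: field_simps)
  qed
  have "ip ?T (($) d) v = (\<Sum>l\<in>?T. if l = ?i then d $ l / a else 0)"
    unfolding ip_def by (intro sum.cong refl) (simp add: vj)
  also have "\<dots> = d $ ?i / a" using T(2) by (simp only: sum.delta insertI1 if_True)
  finally have ip_eq: "ip ?T (($) d) v = d $ ?i / a" .
  have "v ?i = 1 / a" using vj[of ?i] by simp
  then show ?thesis unfolding v(2) ip_eq using a by (simp add: power2_eq_square)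
qed

lemma abs_le_linf_norm:
  assumes "d \<in> carrier_vec n" "j < n"
  shows "\<bar>d $ j\<bar> \<le> linf_norm d"
  unfolding linf_norm_def using assms by (intro Max_ge) auto

end

text \<open>With \<open>s = sqrt (b / a)\<close> and \<open>q = (s - 1) / (s + 1)\<close>, the mean
  of \<open>q\<close> and \<open>1 / q\<close> is \<open>(s^2 + 1) / (s^2 - 1)\<close>.\<close>

lemma tau_decay_rate:
  fixes a b :: real
  assumes ab: "0 < a" "a < b"
  defines "q \<equiv> (sqrt (b / a) - 1) / (sqrt (b / a) + 1)"
  shows "0 < q" "q < 1" "tau q 1 = (b + a) / (b - a)"
proof -
  define s where "s = sqrt (b / a)"
  have s: "1 < s" using ab by (simp add: s_def)
  have b: "b = s\<^sup>2 * a" using ab by (simp add: s_def)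
  have q: "q = (s - 1) / (s + 1)" by (simp add: q_def s_def)
  show "0 < q" "q < 1" using s by (simp_all add: q)
  have "tau q 1 = ((s - 1) / (s + 1) + (s + 1) / (s - 1)) / 2" by (simp add: tau_def q)
  also have "(s - 1) / (s + 1) + (s + 1) / (s - 1) = 2 * ((s\<^sup>2 + 1) / (s\<^sup>2 - 1))"
    using s by (simp add: add_frac_eq power2_eq_square algebra_simps)
  also have "2 * ((s\<^sup>2 + 1) / (s\<^sup>2 - 1)) / 2 = (s\<^sup>2 + 1) / (s\<^sup>2 - 1)"
    by (rule nonzero_mult_div_cancel_left) simp
  also have "\<dots> = (s\<^sup>2 * a + a) / (s\<^sup>2 * a - a)"
  proof -
    have "s\<^sup>2 * a + a = a * (s\<^sup>2 + 1)" "s\<^sup>2 * a - a = a * (s\<^sup>2 - 1)" by (simp_all add: algebra_simps)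
    then show ?thesis using ab(1) by simp
  qed
  finally show "tau q 1 = (b + a) / (b - a)" using b by simp
qed

text \<open>After taking logarithms the claim is the lower bound on \<open>m\<close>; dividing by
  \<open>ln q < 0\<close> is what brings in \<open>\<bar>ln q\<bar>\<close>.\<close>

lemma power_root_depth_le:
  fixes q X \<epsilon> :: real
  assumes q: "0 < q" "q < 1" and k: "1 \<le> k" and pos: "0 < X" "0 < \<epsilon>"
    and m: "real k / \<bar>ln q\<bar> * ln (X / \<epsilon>) \<le> real m"
  shows "X * (q powr (1 / k)) ^ m \<le> \<epsilon>"
proof -
  have l: "ln q < 0" using q by simp
  have "ln (X / \<epsilon>) \<le> real m / real k * (- ln q)"
    using m l k by (simp add: field_simps)
  then have "ln X + real m / real k * ln q \<le> ln \<epsilon>" using pos by (simp add: ln_div)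
  then have "exp (ln X + real m / real k * ln q) \<le> exp (ln \<epsilon>)" by simp
  then have "X * exp (real m / real k * ln q) \<le> \<epsilon>" using pos by (simp add: exp_add)
  moreover have "(q powr (1 / k)) ^ m = exp (real m / real k * ln q)"
    using q by (simp add: powr_def exp_of_nat_mult[symmetric])
  ultimately show ?thesis by simp
qed

theorem theorem1:
  fixes k :: nat and lmin lmax :: real
  assumes "k \<ge> 1"
  shows "\<exists>C>0. \<forall>(n::nat) (Q::real mat) (c::real vec) (d::real vec) (\<epsilon>::real).
    n \<ge> 1 \<and> sym_pos_def n Q \<and> has_bandwidth n k Q \<and>
    Min (spectrum Q) = lmin \<and> Max (spectrum Q) = lmax \<and>
    c \<in> carrier_vec n \<and> d \<in> carrier_vec n \<and> \<epsilon> > 0 \<longrightarrow>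
    (\<exists>h h_m. is_optimal_value n Q c d h \<and>
      is_shortest_path_length n Q c d (truncation_depth n k Q d C \<epsilon>) h_m \<and>
      \<bar>h_m - h\<bar> \<le> \<epsilon>)"
proof -
  define q where "q = (sqrt (lmax / lmin) - 1) / (sqrt (lmax / lmin) + 1)"
  define r where "r = q powr (1 / k)"
  define V where "V = column_bound lmin r"
  define E where "E = truncation_bound lmin lmax k q r"
  \<comment> \<open>The first value is the factor in \<open>truncated_quotient_diff\<close>. The
    value 1 only keeps \<open>C\<close> positive for the remaining pairs \<open>lmin\<close>,
    \<open>lmax\<close>, among them equal ones.\<close>
  define C where "C = (if 0 < lmin \<and> lmin < lmax then 2 * lmax * V * E + lmax\<^sup>2 * V\<^sup>2 * E else 1)"
  have r: "0 < r" "r ^ k = q" "r < 1" if "0 < lmin" "lmin < lmax"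
  proof -
    have q: "0 < q" "q < 1" using tau_decay_rate[OF that] by (simp_all add: q_def)
    then show "0 < r" "r ^ k = q" using assms by (simp_all add: r_def powr_power)
    then show "r < 1" using q by (metis linorder_not_le one_le_power)
  qed
  have banded: "banded_form {..<n} (entries Q) lmin lmax k q r"
    if ev: "0 < lmin" "lmin < lmax" and H: "n \<ge> 1" "sym_pos_def n Q" "has_bandwidth n k Q"
      "Min (spectrum Q) = lmin" "Max (spectrum Q) = lmax" for n Q
  proof -
    interpret spd n Q by unfold_locales (rule H)
    show ?thesis
    proof
      show "lmin * ip {..<n} x x \<le> ip {..<n} x (app {..<n} (entries Q) x)"
        "ip {..<n} x (app {..<n} (entries Q) x) \<le> lmax * ip {..<n} x x" for x
        using spectrum_form_bounds(3,4)[OF H(2,1)] H(4,5) by auto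
      show "Q $$ (i, j) = 0" if "i \<in> {..<n}" "j \<in> {..<n}" "int k < \<bar>int i - int j\<bar>" for i j
        using that H(3) by (simp add: has_bandwidth_def)
    qed (use sym_Q assms ev r tau_decay_rate[OF ev] in \<open>auto simp: q_def\<close>)
  qed
  have key: "\<bar>(d \<bullet> transition_vec Q (snd (node Q p)) (length p))\<^sup>2 -
       (d \<bullet> transition_vec Q (snd (node Q (truncate_word m p))) (length p))\<^sup>2\<bar>
      \<le> C * ((linf_norm d)\<^sup>2 * r ^ m)"
    if ev: "0 < lmin" "lmin < lmax" and H: "n \<ge> 1" "sym_pos_def n Q" "has_bandwidth n k Q"
      "Min (spectrum Q) = lmin" "Max (spectrum Q) = lmax"
    and d: "d \<in> carrier_vec n" and p: "length p < n" for n Q d p m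
  proof -
    interpret spd n Q by unfold_locales (rule H)
    interpret full: banded_form "{..<n}" "entries Q" lmin lmax k q r by (rule banded[OF ev H])
    let ?i = "length p"
    define T where "T = insert ?i (ones p)"
    define T' where "T' = {j \<in> T. ?i \<le> j + m}"
    \<comment> \<open>Truncation keeps the length of the word, so the same index \<open>?i\<close>
      is decided and only the active set shrinks to its window.\<close>
    have T'_eq: "T' = insert (length (truncate_word m p)) (ones (truncate_word m p))"
      by (auto simp: T'_def T_def ones_truncate_word)
    have T: "T \<subseteq> {..<n}" "T \<subseteq> {..?i}" "?i \<in> T" using ones_subset[of p] p by (fastforce simp: T_def)+
    interpret T: banded_form T "entries Q" lmin lmax k q r by (rule full.subset_banded_form[OF T(1)])
    obtain v where v: "\<And>j. j \<in> T \<Longrightarrow> app T (entries Q) v j = of_bool (j = ?i)"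
      "(d \<bullet> transition_vec Q (snd (node Q p)) ?i)\<^sup>2 = (ip T (($) d) v)\<^sup>2 / v ?i"
      using node_transition_quotient[OF d p] unfolding T_def by blast
    obtain w where w: "\<And>j. j \<in> T' \<Longrightarrow> app T' (entries Q) w j = of_bool (j = ?i)"
      "(d \<bullet> transition_vec Q (snd (node Q (truncate_word m p))) ?i)\<^sup>2 = (ip T' (($) d) w)\<^sup>2 / w ?i"
      using node_transition_quotient[OF d, of "truncate_word m p"] p unfolding T'_eq by auto
    have "\<bar>d $ j\<bar> \<le> linf_norm d" if "j \<in> T" for j
      using abs_le_linf_norm[OF d] that T(1) by auto
    from T.truncated_quotient_diff[OF T(3,2) v(1) w(1)[unfolded T'_def] this, folded T'_def]
    show ?thesis using v(2) w(2) ev by (simp add: C_def V_def E_def)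
  qed
  have VE: "0 < V" "0 < E" if "0 < lmin" "lmin < lmax"
    using column_bound_pos truncation_bound_pos that r[OF that] tau_decay_rate(1)[OF that]
    by (simp_all add: V_def E_def q_def)
  have C: "0 < C"
    using VE by (auto simp: C_def intro!: add_pos_pos)
  have "\<exists>h h_m. is_optimal_value n Q c d h \<and>
      is_shortest_path_length n Q c d (truncation_depth n k Q d C \<epsilon>) h_m \<and> \<bar>h_m - h\<bar> \<le> \<epsilon>"
    if H: "n \<ge> 1" "sym_pos_def n Q" "has_bandwidth n k Q"
      "Min (spectrum Q) = lmin" "Max (spectrum Q) = lmax"
      and cd: "c \<in> carrier_vec n" "d \<in> carrier_vec n" and \<epsilon>: "\<epsilon> > 0" for n Q c d \<epsilon>
  proof -
    interpret spd n Q by unfold_locales (rule H)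
    define m where "m = truncation_depth n k Q d C \<epsilon>"
    have l: "0 < lmin" "lmin \<le> lmax" using spectrum_form_bounds(1,2)[OF H(2,1)] H(4,5) by auto
    define D where "D = linf_norm d"
    have "\<exists>e\<ge>0. real n * e \<le> \<epsilon> \<and> (\<forall>p. length p < n \<longrightarrow>
      \<bar>(d \<bullet> transition_vec Q (snd (node Q p)) (length p))\<^sup>2 -
       (d \<bullet> transition_vec Q (snd (node Q (truncate_word m p))) (length p))\<^sup>2\<bar> \<le> 2 * e)"
    \<comment> \<open>For equal eigenvalues the decay rate is 0 and the depth 0 by convention;
      merging then causes no error at all, so \<open>e = 0\<close> works.\<close>
    proof (cases "lmin = lmax")
      case True
      have eq: "ip {..<n} x (app {..<n} (entries Q) x) = lmin * ip {..<n} x x" for x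
        using spectrum_form_bounds(3,4)[OF H(2,1), of x] H(4,5) True by simp
      have "(d \<bullet> transition_vec Q (snd (node Q p)) (length p))\<^sup>2 =
          (d \<bullet> transition_vec Q (snd (node Q (truncate_word m p))) (length p))\<^sup>2" if "length p < n" for p
        using scalar_transition[OF eq _ cd(2), of p] scalar_transition[OF eq _ cd(2), of "truncate_word m p"]
          l(1) that by simp
      then show ?thesis using \<epsilon> by (intro exI[of _ 0]) auto
    next
      case False
      then have ev: "0 < lmin" "lmin < lmax" using l by auto
      define e where "e = C * (D\<^sup>2 * r ^ m)"
      have e0: "0 \<le> e" using C r[OF ev] by (simp add: e_def)
      have "n * e \<le> \<epsilon>"
      \<comment> \<open>The logarithm in the depth formula is meaningful only for \<open>D\<close>
        nonzero; for \<open>D = 0\<close> the error bound \<open>e\<close> is 0 whatever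
        \<open>m\<close> is.\<close>
      proof (cases "D = 0")
        case True
        then show ?thesis using \<epsilon> by (simp add: e_def)
      next
        case False
        have q: "0 < q" "q < 1" using tau_decay_rate[OF ev] by (simp_all add: q_def)
        have dr: "decay_rate Q = q" by (simp add: decay_rate_def cond_number_def H q_def)
        have "d \<noteq> 0\<^sub>v n"
        proof
          assume "d = 0\<^sub>v n"
          then have "linf_norm d = Max ((\<lambda>i. 0) ` {..<n})"
            unfolding linf_norm_def by (intro arg_cong[of _ _ Max] image_cong) auto
          then show False using False H(1) by (simp add: D_def image_constant_conv lessThan_empty_iff)
        qed
        then have "m = nat \<lceil>real k / \<bar>ln q\<bar> * ln (C * D\<^sup>2 * real n / \<epsilon>)\<rceil>"
          using q by (simp add: m_def truncation_depth_def dr D_def)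
        \<comment> \<open>This also covers a negative right-hand side, where \<open>nat\<close>
          turns the depth into 0.\<close>
        then have "real k / \<bar>ln q\<bar> * ln (C * D\<^sup>2 * real n / \<epsilon>) \<le> real m"
          using real_nat_ceiling_ge by blast
        from power_root_depth_le[OF q assms _ \<epsilon> this]
        have "C * D\<^sup>2 * real n * r ^ m \<le> \<epsilon>" using C False H(1) by (simp add: r_def)
        then show ?thesis by (simp add: e_def mult_ac)
      qed
      \<comment> \<open>The bound \<open>e\<close> from \<open>key\<close> is simply weakened to
        \<open>2 * e\<close>.\<close>
      moreover have "\<bar>(d \<bullet> transition_vec Q (snd (node Q p)) (length p))\<^sup>2 -
         (d \<bullet> transition_vec Q (snd (node Q (truncate_word m p))) (length p))\<^sup>2\<bar> \<le> 2 * e"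
        if "length p < n" for p
        using key[OF ev H cd(2) that, of m] e0 by (simp add: e_def D_def)
      ultimately show ?thesis using e0 by blast
    qed
    then obtain e where e: "0 \<le> e" "real n * e \<le> \<epsilon>" "\<And>p. length p < n \<Longrightarrow>
      \<bar>(d \<bullet> transition_vec Q (snd (node Q p)) (length p))\<^sup>2 -
       (d \<bullet> transition_vec Q (snd (node Q (truncate_word m p))) (length p))\<^sup>2\<bar> \<le> 2 * e"
      by blast
    have "\<bar>Min (truncated_cost Q c d m ` {p. length p = n}) - Min (exact_cost c d ` {p. length p = n})\<bar> \<le> \<epsilon>"
      using Min_cost_diff_le[OF e(3,1), of c] e(2) by (rule order_trans)
    then show ?thesis
      using optimal_value_exact[OF cd(2)] shortest_path_truncated_dd[OF dim_Q(1)] unfolding m_def by blast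
  qed
  then show ?thesis using C by blast
qed

end
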